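(* Let $G=(V,E)$ be a finite connected loopless graph with integer edge lengths $\ell\colon E\to\mathbb{Z}_{>0}$ and let $\mathfrak{m}\in C^1(G,\mathbb{Z})$. The polytopes $\mathrm{Vor}^\mathfrak{m}_H(f)$, for $f\in C^0(G,\mathbb{Z})$ with $G^\mathfrak{m}_f$ connected, provide a tiling $\mathrm{Vor}^\mathfrak{m}_{G,\ell}$ of $H_{0,\mathbb{R}}$. Each top-dimensional cell of this tiling is congruent to the Voronoi cell of a connected subgraph of $G$; more precisely, $\mathrm{Vor}^\mathfrak{m}_H(f)$ is congruent to $\mathrm{Vor}_{G^\mathfrak{m}_f}(O)$ for each $f\in C^0(G,\mathbb{Z})$ with $G^\mathfrak{m}_f$ connected.
   Context: $\mathbb{E}$: oriented edges ($e=uv$: tail $u$, head $v$); $\ell_{\bar e}=\ell_e$. $C^0(G,A)$ = functions $V\to A$; $C^1(G,A)$ = $x\colon\mathbb{E}\to A$ with $x_{\bar e}=-x_e$; $d^*(x)(v)=\sum_{e:\ \mathrm{head}(e)=v}x_e$; $H_{0,\mathbb{R}}=\{f\in C^0(G,\mathbb{R}):\sum_vf(v)=0\}$. For $f\in C^0(G,\mathbb{Z})$ and $e=uv$, put $a_e=f(v)-f(u)+\mathfrak{m}_e$; $\mathfrak{d}^\mathfrak{m}_f(e)=a_e/\ell_e$ if $\ell_e\mid a_e$ and $\lfloor a_e/\ell_e\rfloor+\frac12$ otherwise. $G^\mathfrak{m}_f$ is the spanning subgraph whose edges are those with $\ell_e\mid a_e$. $\square^\mathfrak{m}_f=\{\mathfrak{d}^\mathfrak{m}_f+\epsilon:|\epsilon_e|\le\frac12\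 \forall e,\ \epsilon_e=0\text{ for }e\notin G^\mathfrak{m}_f\}$, and $\mathrm{Vor}^\mathfrak{m}_H(f):=d^*(\square^\mathfrak{m}_f)$ (for $G^\mathfrak{m}_f$ connected). For a connected spanning subgraph $G'$, $\mathrm{Vor}_{G'}(O)$ is the Voronoi cell of the origin in $H_{0,\mathbb{R}}$ for the lattice $d'^*d'(C^0(G',\mathbb{Z}))$ and quadratic form $q'(h)=\langle f,\Delta'f\rangle$ with $\Delta'f=h$, where $d'$, $d'^*$, $\Delta'=d'^*d'$ are the coboundary, its adjoint, and the Laplacian of $G'$. A tiling is a family of polytopes covering the space, closed under faces, any two meeting in a common face or not at all. *)

theory Defs
  imports "HOL-Analysis.Analysis" "Graph_Theory.Graph_Theory"
begin

text \<open>
  A finite undirected multigraph is a bidirected digraph \<^term>\<open>G\<close>: its arcs are the oriented edges,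
  and \<open>arev\<close> is the orientation reversal. The vertex set is the whole of a finite type \<open>'v\<close>, so that
  the 0-cochains with values in \<open>'a\<close> are the vectors \<^typ>\<open>'a ^ 'v\<close>. Cochains of degree 1 are
  functions on the arc type whose values outside \<^term>\<open>arcs G\<close> are irrelevant.
\<close>

definition C1 :: "('v, 'e) pre_digraph \<Rightarrow> ('e \<Rightarrow> 'e) \<Rightarrow> ('e \<Rightarrow> 'a::ab_group_add) set" where
  "C1 G arev = {x. \<forall>e\<in>arcs G. x (arev e) = - x e}"

definition coboundary :: "('v::finite, 'e) pre_digraph \<Rightarrow> 'a::ab_group_add ^ 'v \<Rightarrow> 'e \<Rightarrow> 'a" where
  "coboundary G f e = f $ head G e - f $ tail G e"

definition coboundary_adj :: "('v::finite, 'e) pre_digraph \<Rightarrow> ('e \<Rightarrow> 'a::ab_group_add) \<Rightarrow> 'a ^ 'v" where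
  "coboundary_adj G x = (\<chi> v. \<Sum>e | e \<in> arcs G \<and> head G e = v. x e)"

definition laplacian :: "('v::finite, 'e) pre_digraph \<Rightarrow> 'a::ab_group_add ^ 'v \<Rightarrow> 'a ^ 'v" where
  "laplacian G f = coboundary_adj G (coboundary G f)"

definition H0 :: "(real ^ 'v::finite) set" where
  "H0 = {h. (\<Sum>v\<in>UNIV. h $ v) = 0}"


definition of_int_vec :: "int ^ 'v::finite \<Rightarrow> real ^ 'v" where
  "of_int_vec f = (\<chi> v. real_of_int (f $ v))"

definition laplacian_lattice :: "('v::finite, 'e) pre_digraph \<Rightarrow> (real ^ 'v) set" where
  "laplacian_lattice G = range (\<lambda>f :: int ^ 'v. of_int_vec (laplacian G f))"

text \<open>
  For connected \<^term>\<open>G\<close> and \<open>h \<in> H0\<close>, the equation \<open>laplacian G f = h\<close> determines \<open>f\<close> up to an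
  additive constant, on which the value below does not depend.
\<close>

definition laplacian_form :: "('v::finite, 'e) pre_digraph \<Rightarrow> real ^ 'v \<Rightarrow> real" where
  "laplacian_form G h = (THE r. \<exists>f. laplacian G f = h \<and> r = f \<bullet> laplacian G f)"

definition voronoi_cell :: "'a::ab_group_add set \<Rightarrow> 'a set \<Rightarrow> ('a \<Rightarrow> real) \<Rightarrow> 'a \<Rightarrow> 'a set" where
  "voronoi_cell X L q p = {x \<in> X. \<forall>y\<in>L. q (x - p) \<le> q (x - y)}"

definition Vor_origin :: "('v::finite, 'e) pre_digraph \<Rightarrow> (real ^ 'v) set" where
  "Vor_origin G = voronoi_cell H0 (laplacian_lattice G) (laplacian_form G) 0"


definition twisted_diff :: "('v::finite, 'e) pre_digraph \<Rightarrow> ('e \<Rightarrow> int) \<Rightarrow> int ^ 'v \<Rightarrow> 'e \<Rightarrow> int" where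
  "twisted_diff G m f e = f $ head G e - f $ tail G e + m e"

definition dd :: "('v::finite, 'e) pre_digraph \<Rightarrow> ('e \<Rightarrow> int) \<Rightarrow> ('e \<Rightarrow> int) \<Rightarrow> int ^ 'v \<Rightarrow> 'e \<Rightarrow> real" where
  "dd G l m f e =
     (if l e dvd twisted_diff G m f e
      then real_of_int (twisted_diff G m f e) / real_of_int (l e)
      else real_of_int \<lfloor>real_of_int (twisted_diff G m f e) / real_of_int (l e)\<rfloor> + 1 / 2)"

definition Gf ::
  "('v::finite, 'e) pre_digraph \<Rightarrow> ('e \<Rightarrow> int) \<Rightarrow> ('e \<Rightarrow> int) \<Rightarrow> int ^ 'v \<Rightarrow> ('v, 'e) pre_digraph" where
  "Gf G l m f = G\<lparr>arcs := {e \<in> arcs G. l e dvd twisted_diff G m f e}\<rparr>"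

definition box_cell ::
  "('v::finite, 'e) pre_digraph \<Rightarrow> ('e \<Rightarrow> 'e) \<Rightarrow> ('e \<Rightarrow> int) \<Rightarrow> ('e \<Rightarrow> int) \<Rightarrow> int ^ 'v \<Rightarrow> ('e \<Rightarrow> real) set" where
  "box_cell G arev l m f =
     {\<lambda>e. dd G l m f e + \<epsilon> e | \<epsilon>. \<epsilon> \<in> C1 G arev \<and> (\<forall>e\<in>arcs G. \<bar>\<epsilon> e\<bar> \<le> 1 / 2)
        \<and> (\<forall>e \<in> arcs G - arcs (Gf G l m f). \<epsilon> e = 0)}"

definition VorH ::
  "('v::finite, 'e) pre_digraph \<Rightarrow> ('e \<Rightarrow> 'e) \<Rightarrow> ('e \<Rightarrow> int) \<Rightarrow> ('e \<Rightarrow> int) \<Rightarrow> int ^ 'v \<Rightarrow> (real ^ 'v) set" where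
  "VorH G arev l m f = coboundary_adj G ` box_cell G arev l m f"


text \<open>
  The library relation \<open>face_of\<close> counts the empty set as a face; here faces are nonempty. The name
  \<open>connected\<close> is qualified because the topological notion has the same base name.
\<close>

definition is_tiling :: "'a::euclidean_space set set \<Rightarrow> 'a set \<Rightarrow> bool" where
  "is_tiling T X \<longleftrightarrow>
     (\<forall>P\<in>T. polytope P \<and> P \<noteq> {}) \<and>
     \<Union>T = X \<and>
     (\<forall>P\<in>T. \<forall>F. F face_of P \<and> F \<noteq> {} \<longrightarrow> F \<in> T) \<and>
     (\<forall>P\<in>T. \<forall>Q\<in>T. P \<inter> Q = {} \<or> (P \<inter> Q) face_of P \<and> (P \<inter> Q) face_of Q)"

definition Vor_tiling ::
  "('v::finite, 'e) pre_digraph \<Rightarrow> ('e \<Rightarrow> 'e) \<Rightarrow> ('e \<Rightarrow> int) \<Rightarrow> ('e \<Rightarrow> int) \<Rightarrow> (real ^ 'v) set set" where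
  "Vor_tiling G arev l m =
     {F. F \<noteq> {} \<and> (\<exists>f. Digraph_Component.connected (Gf G l m f) \<and> F face_of VorH G arev l m f)}"

definition top_dim_cells :: "'a::euclidean_space set set \<Rightarrow> 'a set \<Rightarrow> 'a set set" where
  "top_dim_cells T X = {P \<in> T. aff_dim P = aff_dim X}"

text \<open>
  Congruence is by translation, which is an isometry for every norm on the ambient space; no norm
  has to be singled out among those attached to the various subgraphs.
\<close>

definition congruent_cells :: "'a::ab_group_add set \<Rightarrow> 'a set \<Rightarrow> bool" where
  "congruent_cells P Q \<longleftrightarrow> (\<exists>c. P = (+) c ` Q)"

text \<open>A subgraph of the undirected graph contains an oriented edge iff it contains its reversal.\<close>

definition connected_spanning_subgraph ::
  "('v, 'e) pre_digraph \<Rightarrow> ('v, 'e) pre_digraph \<Rightarrow> ('e \<Rightarrow> 'e) \<Rightarrow> bool" where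
  "connected_spanning_subgraph H G arev \<longleftrightarrow>
     spanning H G \<and> (\<forall>e\<in>arcs H. arev e \<in> arcs H) \<and> Digraph_Component.connected H"

end

theory Submission
  imports Defs
begin

text \<open>
  Let \<open>\<phi>\<close> be the piecewise linear interpolation of \<open>u\<^sup>2 / 2\<close> at the integers and let
  \<open>F g\<close> be the sum of \<open>l e * \<phi> ((g v - g u + m e) / l e)\<close> over the edges \<open>e = u v\<close>, a convex
  piecewise linear function of a real potential \<open>g\<close>. The polytope \<open>VorH f\<close> is the subdifferential of
  \<open>F\<close> at \<open>f\<close>. Hence two such polytopes meet in the common face on which the subgradient inequality
  between the two points is an equality. Minimising \<open>F g - \<langle>g, h\<rangle>\<close> shows that every \<open>h\<close> of sum zero
  is a subgradient somewhere. Sliding \<open>g\<close> along cuts makes more and more edges integral without losing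
  \<open>h\<close>, until the integral edges connect the graph and \<open>g\<close> is, up to a constant, an integer vector.
  Up to translation, \<open>VorH f\<close> is the polytope at the origin for the graph \<open>Gf\<close> with unit lengths and
  no twist. There \<open>2 F z\<close> is the quadratic form at the lattice vector \<open>\<Delta> z\<close> for integer \<open>z\<close>, so that
  the subgradient inequalities at integer points are the Voronoi inequalities.
\<close>

subsection \<open>Interpolation of the square function\<close>

text \<open>The chord of \<open>u^2 / 2\<close> over \<open>[n, n + 1]\<close> with
  \<open>n = floor u\<close> has slope \<open>n + 1 / 2\<close> and intercept
  \<open>- n * (n + 1) / 2\<close>.\<close>

definition interp_sq :: "real \<Rightarrow> real" where
  "interp_sq u = (of_int \<lfloor>u\<rfloor> + 1 / 2) * u - of_int \<lfloor>u\<rfloor> * (of_int \<lfloor>u\<rfloor> + 1) / 2"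

text \<open>This is the subdifferential of \<open>interp_sq\<close>. Away from the integers the two
  bounds coincide; at an integer they are the slopes of the two adjacent chords.\<close>

definition slopes :: "real \<Rightarrow> real set" where
  "slopes u = {of_int \<lceil>u\<rceil> - 1 / 2 .. of_int \<lfloor>u\<rfloor> + 1 / 2}"

lemma interp_sq_on_unit_interval:
  assumes "of_int n \<le> u" "u \<le> of_int n + 1"
  shows "interp_sq u = (of_int n + 1 / 2) * u - of_int n * (of_int n + 1) / 2"
proof (cases "u = of_int n + 1")
  case True
  then have "\<lfloor>u\<rfloor> = n + 1" by simp
  with True show ?thesis by (simp add: interp_sq_def field_simps)
next
  case False
  then have "\<lfloor>u\<rfloor> = n" using assms by linarith
  then show ?thesis by (simp add: interp_sq_def)
qed

lemma interp_sq_of_int [simp]: "interp_sq (of_int n) = (of_int n)\<^sup>2 / 2"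
  by (simp add: interp_sq_def power2_eq_square field_simps)

text \<open>With \<open>k = floor u\<close>, the chord over \<open>[k, k + 1]\<close> minus the line
  extending the \<open>n\<close>-th chord factors as \<open>(k - n) * (u - (k + n + 1) / 2)\<close>,
  and the two factors never have opposite signs.\<close>

lemma interp_sq_ge_line:
  "interp_sq u \<ge> (of_int n + 1 / 2) * u - of_int n * (of_int n + 1) / 2"
proof -
  define k where "k = \<lfloor>u\<rfloor>"
  have k: "of_int k \<le> u" "u < of_int k + 1" unfolding k_def by linarith+
  have "0 \<le> (of_int k - of_int n) * (u - (of_int k + of_int n + 1) / 2)"
  proof (rule linorder_cases[of k n])
    assume "k < n"
    then have "real_of_int k + 1 \<le> of_int n" by linarith
    then show ?thesis using k by (intro mult_nonpos_nonpos) auto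
  next
    assume "n < k"
    then have "real_of_int n + 1 \<le> of_int k" by linarith
    then show ?thesis using k by (intro mult_nonneg_nonneg) auto
  qed simp
  then show ?thesis unfolding interp_sq_def k_def[symmetric] by (simp add: field_simps)
qed

lemma interp_sq_ge_sq: "u\<^sup>2 / 2 \<le> interp_sq u"
proof -
  have "0 \<le> (u - of_int \<lfloor>u\<rfloor>) * (of_int \<lfloor>u\<rfloor> + 1 - u)"
    by (intro mult_nonneg_nonneg) linarith+
  then show ?thesis by (simp add: interp_sq_def power2_eq_square field_simps)
qed

lemma slopes_of_int [simp]: "slopes (of_int n) = {of_int n - 1 / 2 .. of_int n + 1 / 2}"
  by (simp add: slopes_def)

lemma slopes_not_int:
  assumes "u \<notin> \<int>"
  shows "slopes u = {of_int \<lfloor>u\<rfloor> + 1 / 2}"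
proof -
  have "\<lceil>u\<rceil> = \<lfloor>u\<rfloor> + 1" using assms Ints_of_int by (metis ceiling_altdef)
  then show ?thesis by (auto simp: slopes_def)
qed

lemma slopes_nonempty: "of_int \<lfloor>u\<rfloor> + 1 / 2 \<in> slopes u" "of_int \<lceil>u\<rceil> - 1 / 2 \<in> slopes u"
proof -
  have "real_of_int \<lceil>u\<rceil> \<le> of_int \<lfloor>u\<rfloor> + 1" by (simp add: ceiling_altdef)
  then show "of_int \<lfloor>u\<rfloor> + 1 / 2 \<in> slopes u" "of_int \<lceil>u\<rceil> - 1 / 2 \<in> slopes u"
    unfolding slopes_def by auto
qed

lemma slopes_uminus: "s \<in> slopes u \<longleftrightarrow> - s \<in> slopes (- u)"
  by (auto simp: slopes_def ceiling_minus floor_minus)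

text \<open>The lines extending the chords are global minorants, which gives one direction. For the
  other, testing the subgradient inequality at the nearest integer on either side bounds the slope
  from above and from below.\<close>

lemma slopes_iff_subgradient:
  "s \<in> slopes u \<longleftrightarrow> (\<forall>w. interp_sq u + s * (w - u) \<le> interp_sq w)"
proof
  assume s: "s \<in> slopes u"
  show "\<forall>w. interp_sq u + s * (w - u) \<le> interp_sq w"
  proof
    fix w
    show "interp_sq u + s * (w - u) \<le> interp_sq w"
    proof (cases "u \<in> \<int>")
      case True
      then obtain n where n: "u = of_int n" by (auto elim: Ints_cases)
      have 1: "(n + 1 / 2) * w - n * (n + 1) / 2 \<le> interp_sq w"
        using interp_sq_ge_line[of n w] by simp
      have 2: "(n - 1 / 2) * w - n * (n - 1) / 2 \<le> interp_sq w"
        using interp_sq_ge_line[of "n - 1" w] by (simp add: algebra_simps)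
      have sb: "of_int n - 1 / 2 \<le> s" "s \<le> of_int n + 1 / 2" using s by (auto simp: n)
      show ?thesis
      proof (cases "w \<ge> u")
        case True
        then have "s * (w - u) \<le> (of_int n + 1 / 2) * (w - u)" using sb by (intro mult_right_mono) auto
        with 1 show ?thesis by (simp add: n power2_eq_square field_simps)
      next
        case False
        then have "s * (w - u) \<le> (of_int n - 1 / 2) * (w - u)" using sb by (intro mult_right_mono_neg) auto
        with 2 show ?thesis by (simp add: n power2_eq_square field_simps)
      qed
    next
      case False
      then have s: "s = of_int \<lfloor>u\<rfloor> + 1 / 2" using s by (simp add: slopes_not_int)
      show ?thesis using interp_sq_ge_line[of "\<lfloor>u\<rfloor>" w]
        unfolding interp_sq_def[of u] s by (simp add: field_simps)
    qed
  qed
next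
  assume sub: "\<forall>w. interp_sq u + s * (w - u) \<le> interp_sq w"
  \<comment> \<open>The pieces \<open>[n, n + 1]\<close> and \<open>[k, k + 1]\<close> lie to the
    right and to the left of \<open>u\<close>. They differ when \<open>u\<close> is an integer, so
    that the test points \<open>n + 1\<close> and \<open>k\<close> are always distinct from
    \<open>u\<close>.\<close>
  define n where "n = \<lfloor>u\<rfloor>"
  define k where "k = \<lceil>u\<rceil> - 1"
  have n: "of_int n \<le> u" "u < of_int n + 1" unfolding n_def by linarith+
  have k: "of_int k < u" "u \<le> of_int k + 1" unfolding k_def by linarith+
  have "interp_sq (of_int n + 1) = interp_sq u + (n + 1 / 2) * (of_int n + 1 - u)"
    using interp_sq_on_unit_interval[of n u] interp_sq_on_unit_interval[of n "of_int n + 1"] n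
    by (simp add: field_simps)
  with sub[rule_format, of "of_int n + 1"]
  have "s * (of_int n + 1 - u) \<le> (n + 1 / 2) * (of_int n + 1 - u)" by simp
  then have "s \<le> n + 1 / 2" using n by (simp add: mult_le_cancel_right)
  moreover have "interp_sq (of_int k) = interp_sq u - (k + 1 / 2) * (u - k)"
    using interp_sq_on_unit_interval[of k u] interp_sq_on_unit_interval[of k "of_int k"] k
    by (simp add: field_simps)
  with sub[rule_format, of "of_int k"]
  have "(k + 1 / 2) * (u - k) \<le> s * (u - k)" by (simp add: algebra_simps)
  then have "k + 1 / 2 \<le> s" using k by (simp add: mult_le_cancel_right)
  ultimately show "s \<in> slopes u" by (simp add: slopes_def n_def k_def)
qed

lemma slopes_transfer:
  assumes "s \<in> slopes u" "interp_sq w = interp_sq u + s * (w - u)"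
  shows "s \<in> slopes w"
  unfolding slopes_iff_subgradient
proof
  fix v
  have "interp_sq u + s * (v - u) \<le> interp_sq v" using assms(1) by (simp add: slopes_iff_subgradient)
  then show "interp_sq w + s * (v - w) \<le> interp_sq v" by (simp add: assms(2) algebra_simps)
qed

text \<open>The slope is that of the linear piece into which \<open>k\<close> points; at an integer
  \<open>u\<close> it therefore depends on the sign of \<open>k\<close>, but it is an end of
  \<open>slopes u\<close> in both cases.\<close>

lemma interp_sq_locally_linear:
  "\<exists>s\<in>slopes u. \<forall>\<^sub>F t in at_right 0. interp_sq (u + t * k) = interp_sq u + t * (s * k)"
proof -
  consider "k = 0" | "k > 0" | "k < 0" by linarith
  then show ?thesis
  proof cases
    case 1
    then show ?thesis using slopes_nonempty(1)[of u] by auto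
  next
    case 2
    define n where "n = \<lfloor>u\<rfloor>"
    have n: "of_int n \<le> u" "u < of_int n + 1" unfolding n_def by linarith+
    have "\<forall>\<^sub>F t in at_right 0. 0 < t \<and> t < (of_int n + 1 - u) / k"
      using eventually_at_right_real[of 0 "(of_int n + 1 - u) / k"] 2 n by simp
    then have "\<forall>\<^sub>F t in at_right 0. interp_sq (u + t * k) = interp_sq u + t * ((n + 1 / 2) * k)"
    proof (rule eventually_mono)
      fix t assume t: "0 < t \<and> t < (of_int n + 1 - u) / k"
      then have "0 \<le> t * k" "t * k < of_int n + 1 - u" using 2 by (auto simp: field_simps)
      then show "interp_sq (u + t * k) = interp_sq u + t * ((n + 1 / 2) * k)"
        using interp_sq_on_unit_interval[of n u] interp_sq_on_unit_interval[of n "u + t * k"] n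
        by (simp add: field_simps)
    qed
    then show ?thesis using slopes_nonempty(1)[of u] unfolding n_def by blast
  next
    case 3
    define n where "n = \<lceil>u\<rceil> - 1"
    have n: "of_int n < u" "u \<le> of_int n + 1" unfolding n_def by linarith+
    have n': "of_int n + 1 / 2 = of_int \<lceil>u\<rceil> - (1 / 2 :: real)" by (simp add: n_def)
    have "\<forall>\<^sub>F t in at_right 0. 0 < t \<and> t < (u - of_int n) / - k"
      using eventually_at_right_real[of 0 "(u - of_int n) / - k"] 3 n
      by (simp add: divide_less_0_iff)
    then have "\<forall>\<^sub>F t in at_right 0. interp_sq (u + t * k) = interp_sq u + t * ((n + 1 / 2) * k)"
    proof (rule eventually_mono)
      fix t assume t: "0 < t \<and> t < (u - of_int n) / - k"
      then have "k * t \<le> 0" "of_int n - u < t * k" using 3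
        by (auto simp: field_simps intro: mult_nonpos_nonneg)
      then show "interp_sq (u + t * k) = interp_sq u + t * ((n + 1 / 2) * k)"
        using interp_sq_on_unit_interval[of n u] interp_sq_on_unit_interval[of n "u + t * k"] n
        by (simp add: field_simps)
    qed
    then show ?thesis using slopes_nonempty(2)[of u] unfolding n' by blast
  qed
qed

lemma convex_on_interp_sq: "convex_on UNIV interp_sq"
proof (rule convex_onI)
  fix t x y :: real
  assume t: "0 < t" "t < 1"
  define z where "z = (1 - t) *\<^sub>R x + t *\<^sub>R y"
  obtain s where "s \<in> slopes z" using slopes_nonempty by blast
  then have "interp_sq z + s * (x - z) \<le> interp_sq x" "interp_sq z + s * (y - z) \<le> interp_sq y"
    by (auto simp: slopes_iff_subgradient)
  then have "(1 - t) * (interp_sq z + s * (x - z)) + t * (interp_sq z + s * (y - z))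
      \<le> (1 - t) * interp_sq x + t * interp_sq y"
    using t by (intro add_mono mult_left_mono) auto
  moreover have "(1 - t) * (interp_sq z + s * (x - z)) + t * (interp_sq z + s * (y - z)) = interp_sq z"
    by (simp add: z_def algebra_simps)
  ultimately show "interp_sq ((1 - t) *\<^sub>R x + t *\<^sub>R y) \<le> (1 - t) * interp_sq x + t * interp_sq y"
    by (simp add: z_def)
qed simp

lemma continuous_on_interp_sq: "continuous_on A interp_sq"
  using convex_on_continuous[OF open_UNIV convex_on_interp_sq] continuous_on_subset by blast

text \<open>The centre subtracted from \<open>x\<close> is the value of \<open>dd\<close> in terms
  of the quotient \<open>u\<close>, so this translates the definition of \<open>box_cell\<close>
  into subgradients.\<close>

lemma abs_diff_le_half_iff_slopes:
  "\<bar>x - (if u \<in> \<int> then u else of_int \<lfloor>u\<rfloor> + 1 / 2)\<bar> \<le> 1 / 2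
     \<and> (u \<notin> \<int> \<longrightarrow> x - (if u \<in> \<int> then u else of_int \<lfloor>u\<rfloor> + 1 / 2) = 0)
   \<longleftrightarrow> x \<in> slopes u"
proof (cases "u \<in> \<int>")
  case True
  then obtain n where n: "u = of_int n" by (auto elim: Ints_cases)
  have "\<bar>x - of_int n\<bar> \<le> 1 / 2 \<longleftrightarrow> x \<in> slopes u" unfolding n slopes_of_int
    by (simp only: atLeastAtMost_iff abs_le_iff) auto
  with True show ?thesis by (simp add: n)
next
  case False
  then show ?thesis by (auto simp: slopes_not_int)
qed

text \<open>The assumptions force \<open>u\<close> to be a non-integer. Its only slope belongs to a
  linear piece, and remains a subgradient up to and including the right end of that piece.\<close>

lemma slopes_mono:
  assumes "u < w" "w \<le> of_int \<lceil>u\<rceil>"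
  shows "slopes u \<subseteq> slopes w"
proof -
  have "\<lceil>w\<rceil> \<le> \<lceil>u\<rceil>" using assms by (simp add: ceiling_le_iff)
  moreover have "\<lfloor>u\<rfloor> \<le> \<lfloor>w\<rfloor>" using assms by (simp add: floor_mono)
  ultimately show ?thesis unfolding slopes_def by auto
qed

subsection \<open>Cuts, sum-zero vectors and zonotopes\<close>

text \<open>The set of vertices reachable from \<open>u\<close> in the symmetric closure is crossed
  by no arc, so it is everything as soon as every proper cut is crossed.\<close>

lemma connected_iff_cut:
  assumes "verts G = UNIV"
  shows "Digraph_Component.connected G \<longleftrightarrow>
    (\<forall>S. S \<noteq> {} \<and> S \<noteq> UNIV \<longrightarrow> (\<exists>e\<in>arcs G. (tail G e \<in> S) \<noteq> (head G e \<in> S)))"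
proof -
  let ?R = "parcs (mk_symmetric G)"
  have *: "Digraph_Component.connected G \<longleftrightarrow> (\<forall>u v. (u, v) \<in> ?R\<^sup>*)"
    using assms by (auto simp: Digraph_Component.connected_def strongly_connected_def reachable_def
        rtrancl_consistent_rtrancl_on
        dest: rtrancl_on_rtranclI)
  show ?thesis unfolding *
  proof (intro iffI allI impI)
    fix S :: "'a set"
    assume conn: "\<forall>u v. (u, v) \<in> ?R\<^sup>*" and S: "S \<noteq> {} \<and> S \<noteq> UNIV"
    then obtain u v where uv: "u \<in> S" "v \<notin> S" by auto
    show "\<exists>e\<in>arcs G. (tail G e \<in> S) \<noteq> (head G e \<in> S)"
    proof (rule ccontr)
      assume no: "\<not> ?thesis"
      have "w \<in> S" if "(u, w) \<in> ?R\<^sup>*" for w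
        using that by induction (use uv no in \<open>auto simp: parcs_mk_symmetric\<close>)
      with conn uv show False by blast
    qed
  next
    fix u v
    assume cut: "\<forall>S. S \<noteq> {} \<and> S \<noteq> UNIV \<longrightarrow> (\<exists>e\<in>arcs G. (tail G e \<in> S) \<noteq> (head G e \<in> S))"
    define S where "S = {w. (u, w) \<in> ?R\<^sup>*}"
    have "u \<in> S" by (simp add: S_def)
    moreover have "(tail G e \<in> S) = (head G e \<in> S)" if "e \<in> arcs G" for e
    proof -
      have "(tail G e, head G e) \<in> ?R" "(head G e, tail G e) \<in> ?R"
        using that by (auto simp: parcs_mk_symmetric)
      then show ?thesis unfolding S_def by (auto intro: rtrancl_into_rtrancl)
    qed
    ultimately have "S = UNIV" using cut by blast
    then show "(u, v) \<in> ?R\<^sup>*" by (auto simp: S_def)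
  qed
qed

lemma subspace_H0: "subspace H0"
  by (auto simp: subspace_def H0_def sum.distrib sum_distrib_left[symmetric])

lemma H0_eq_orthogonal: "H0 = {h. 1 \<bullet> h = 0}"
  by (auto simp: H0_def inner_vec_def)

lemma H0_projection:
  fixes g :: "real ^ 'n"
  obtains c where "g + c *\<^sub>R 1 \<in> H0"
proof
  have "1 \<bullet> (1 :: real ^ 'n) \<noteq> 0" by (simp add: vec_eq_iff)
  then show "g + (- (1 \<bullet> g) / (1 \<bullet> (1 :: real ^ 'n))) *\<^sub>R 1 \<in> H0"
    by (simp only: H0_eq_orthogonal mem_Collect_eq inner_add_right inner_scaleR_right) simp
qed

lemma of_int_vec_0 [simp]: "of_int_vec 0 = 0"
  by (simp add: of_int_vec_def vec_eq_iff)

lemma polytope_sums: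
  fixes S T :: "'a::euclidean_space set"
  assumes "polytope S" "polytope T"
  shows "polytope {x + y | x y. x \<in> S \<and> y \<in> T}"
proof -
  have "linear (\<lambda>p :: 'a \<times> 'a. fst p + snd p)"
    by (intro linearI) (auto simp: algebra_simps)
  then have "polytope ((\<lambda>p. fst p + snd p) ` (S \<times> T))"
    using assms by (intro polytope_linear_image polytope_Times)
  moreover have "(\<lambda>p. fst p + snd p) ` (S \<times> T) = {x + y | x y. x \<in> S \<and> y \<in> T}" by force
  ultimately show ?thesis by simp
qed

text \<open>The set is a Minkowski sum of segments, one for each index, and Minkowski sums preserve
  polytopes.\<close>

lemma polytope_zonotope:
  fixes a :: "'e \<Rightarrow> 'a::euclidean_space"
  assumes "finite A"
  shows "polytope {\<Sum>e\<in>A. x e *\<^sub>R a e | x. \<forall>e\<in>A. x e \<in> {p e..q e :: real}}"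
  using assms
proof induction
  case empty
  show ?case by (simp add: polytope_sing)
next
  case (insert e A)
  let ?Z = "\<lambda>A. {\<Sum>e\<in>A. x e *\<^sub>R a e | x. \<forall>e\<in>A. x e \<in> {p e..q e}}"
  have "polytope ((\<lambda>t. t *\<^sub>R a e) ` {p e..q e})"
    using polytope_interval[of "p e" "q e"]
    by (intro polytope_linear_image linearI) (auto simp: algebra_simps)
  then have "polytope {y + z | y z. y \<in> (\<lambda>t. t *\<^sub>R a e) ` {p e..q e} \<and> z \<in> ?Z A}"
    using insert.IH by (rule polytope_sums)
  moreover have "?Z (insert e A) = {y + z | y z. y \<in> (\<lambda>t. t *\<^sub>R a e) ` {p e..q e} \<and> z \<in> ?Z A}"
  proof (intro equalityI subsetI)
    fix h assume "h \<in> ?Z (insert e A)"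
    then obtain x where x: "\<forall>e\<in>insert e A. x e \<in> {p e..q e}" "h = (\<Sum>e\<in>insert e A. x e *\<^sub>R a e)"
      by blast
    have "h = x e *\<^sub>R a e + (\<Sum>e\<in>A. x e *\<^sub>R a e)" using insert x by simp
    then show "h \<in> {y + z | y z. y \<in> (\<lambda>t. t *\<^sub>R a e) ` {p e..q e} \<and> z \<in> ?Z A}" using x(1) by blast
  next
    fix h assume "h \<in> {y + z | y z. y \<in> (\<lambda>t. t *\<^sub>R a e) ` {p e..q e} \<and> z \<in> ?Z A}"
    then obtain t x where tx: "t \<in> {p e..q e}" "\<forall>e\<in>A. x e \<in> {p e..q e}"
      "h = t *\<^sub>R a e + (\<Sum>e\<in>A. x e *\<^sub>R a e)" by blast
    have "(\<Sum>e'\<in>A. (x(e := t)) e' *\<^sub>R a e') = (\<Sum>e\<in>A. x e *\<^sub>R a e)"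
      using insert by (intro sum.cong) auto
    then have "h = (\<Sum>e'\<in>insert e A. (x(e := t)) e' *\<^sub>R a e')" using insert tx by simp
    moreover have "\<forall>e'\<in>insert e A. (x(e := t)) e' \<in> {p e'..q e'}" using tx by auto
    ultimately show "h \<in> ?Z (insert e A)" by blast
  qed
  ultimately show ?case by simp
qed

subsection \<open>Subdifferentials of the energy\<close>

text \<open>Lengths and twist are parameters because the results are applied both to
  \<open>G\<close> and to the subgraphs \<open>Gf G l m f\<close> with unit lengths and zero
  twist.\<close>

locale metric_graph =
  fixes G :: "('v::finite, 'e) pre_digraph" and arev :: "'e \<Rightarrow> 'e" and l m :: "'e \<Rightarrow> int"
  assumes finite_arcs: "finite (arcs G)"
    and verts: "verts G = UNIV"
    and arev_arcs: "e \<in> arcs G \<Longrightarrow> arev e \<in> arcs G"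
    and arev_arev: "e \<in> arcs G \<Longrightarrow> arev (arev e) = e"
    and tail_arev: "e \<in> arcs G \<Longrightarrow> tail G (arev e) = head G e"
    and l_pos: "e \<in> arcs G \<Longrightarrow> 0 < l e"
    and l_arev: "e \<in> arcs G \<Longrightarrow> l (arev e) = l e"
    and m_arev: "e \<in> arcs G \<Longrightarrow> m (arev e) = - m e"
begin

definition arc_vec :: "'e \<Rightarrow> real ^ 'v" where
  "arc_vec e = axis (head G e) 1 - axis (tail G e) 1"

definition tension :: "real ^ 'v \<Rightarrow> 'e \<Rightarrow> real" where
  "tension g e = (coboundary G g e + of_int (m e)) / of_int (l e)"

definition energy :: "real ^ 'v \<Rightarrow> real" where
  "energy g = (\<Sum>e\<in>arcs G. of_int (l e) * interp_sq (tension g e)) / 2"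

text \<open>The factor \<open>1 / 2\<close> below compensates for every edge contributing both of its orientations.\<close>

definition flow_vec :: "('e \<Rightarrow> real) \<Rightarrow> real ^ 'v" where
  "flow_vec x = (\<Sum>e\<in>arcs G. (x e / 2) *\<^sub>R arc_vec e)"

definition cell :: "real ^ 'v \<Rightarrow> (real ^ 'v) set" where
  "cell g = {flow_vec x | x. \<forall>e\<in>arcs G. x e \<in> slopes (tension g e)}"

lemma head_arev: "e \<in> arcs G \<Longrightarrow> head G (arev e) = tail G e"
  using tail_arev[of "arev e"] arev_arcs arev_arev by simp

lemma sum_arev: "(\<Sum>e\<in>arcs G. F (arev e)) = (\<Sum>e\<in>arcs G. F e)"
  by (rule sum.reindex_bij_witness[of _ arev arev]) (auto simp: arev_arcs arev_arev)

lemma inner_arc_vec: "g \<bullet> arc_vec e = coboundary G g e"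
  by (simp add: arc_vec_def coboundary_def inner_diff_right inner_axis)

lemma inner_flow_vec: "g \<bullet> flow_vec x = (\<Sum>e\<in>arcs G. x e * coboundary G g e) / 2"
  by (simp add: flow_vec_def inner_sum_right inner_arc_vec sum_divide_distrib)

lemma arc_vec_arev: "e \<in> arcs G \<Longrightarrow> arc_vec (arev e) = - arc_vec e"
  by (simp add: arc_vec_def tail_arev head_arev)

lemma tension_arev: "e \<in> arcs G \<Longrightarrow> tension g (arev e) = - tension g e"
  by (simp add: tension_def coboundary_def tail_arev head_arev l_arev m_arev
      minus_divide_left)

lemma tension_add: "tension (g + k) e = tension g e + coboundary G k e / of_int (l e)"
  by (simp add: tension_def coboundary_def add_divide_distrib diff_divide_distrib)

lemma coboundary_adj_eq_sum: "coboundary_adj G x = (\<Sum>e\<in>arcs G. x e *\<^sub>R axis (head G e) (1::real))"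
proof (rule iffD2[OF vec_eq_iff], rule allI)
  fix v
  have "coboundary_adj G x $ v = (\<Sum>e | e \<in> arcs G \<and> head G e = v. x e)"
    by (simp add: coboundary_adj_def)
  also have "\<dots> = (\<Sum>e\<in>arcs G. if head G e = v then x e else 0)"
    using finite_arcs by (subst sum.inter_filter[symmetric]) (auto simp: Int_def)
  also have "\<dots> = (\<Sum>e\<in>arcs G. x e *\<^sub>R axis (head G e) (1::real)) $ v"
    by (auto simp: sum_component axis_def intro!: sum.cong)
  finally show "coboundary_adj G x $ v = (\<Sum>e\<in>arcs G. x e *\<^sub>R axis (head G e) (1::real)) $ v" .
qed

text \<open>Reversing all arcs turns the sum over tails into minus the sum over heads, so both
  halves of \<open>flow_vec x\<close> equal half of \<open>coboundary_adj G x\<close>.\<close>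

lemma flow_vec_eq_coboundary_adj:
  assumes "x \<in> C1 G arev"
  shows "flow_vec x = coboundary_adj G x"
proof -
  have "(\<Sum>e\<in>arcs G. x e *\<^sub>R axis (tail G e) (1::real)) = (\<Sum>e\<in>arcs G. x (arev e) *\<^sub>R axis (tail G (arev e)) 1)"
    by (rule sum_arev[symmetric])
  also have "\<dots> = - (\<Sum>e\<in>arcs G. x e *\<^sub>R axis (head G e) 1)"
    using assms by (auto simp: C1_def tail_arev sum_negf[symmetric] intro!: sum.cong)
  finally have tail_sum: "(\<Sum>e\<in>arcs G. x e *\<^sub>R axis (tail G e) (1::real)) = - coboundary_adj G x"
    by (simp add: coboundary_adj_eq_sum)
  have "flow_vec x = (1 / 2) *\<^sub>R (\<Sum>e\<in>arcs G. x e *\<^sub>R arc_vec e)"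
    by (simp add: flow_vec_def scaleR_sum_right)
  also have "\<dots> = (1 / 2) *\<^sub>R (coboundary_adj G x + coboundary_adj G x)"
    by (simp only: arc_vec_def scaleR_diff_right sum_subtractf tail_sum coboundary_adj_eq_sum[symmetric] diff_minus_eq_add)
  finally show ?thesis by (simp add: scaleR_add_right scaleR_add_left[symmetric])
qed

lemma flow_vec_antisymmetrise: "flow_vec (\<lambda>e. (x e - x (arev e)) / 2) = flow_vec x"
proof -
  have "(\<Sum>e\<in>arcs G. (x (arev e) / 4) *\<^sub>R arc_vec e)
      = (\<Sum>e\<in>arcs G. (x (arev (arev e)) / 4) *\<^sub>R arc_vec (arev e))"
    by (rule sum_arev[symmetric])
  also have "\<dots> = - (\<Sum>e\<in>arcs G. (x e / 4) *\<^sub>R arc_vec e)"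
    by (auto simp: arev_arev arc_vec_arev sum_negf[symmetric] intro!: sum.cong)
  finally have "flow_vec (\<lambda>e. (x e - x (arev e)) / 2)
      = (\<Sum>e\<in>arcs G. (x e / 4) *\<^sub>R arc_vec e) + (\<Sum>e\<in>arcs G. (x e / 4) *\<^sub>R arc_vec e)"
    by (simp add: flow_vec_def diff_divide_distrib scaleR_diff_left sum_subtractf)
  also have "\<dots> = flow_vec x"
    unfolding sum.distrib[symmetric] flow_vec_def
    by (intro sum.cong) (simp_all add: scaleR_add_left[symmetric])
  finally show ?thesis .
qed

lemma polytope_cell: "polytope (cell g)"
proof -
  have eq: "flow_vec x = (\<Sum>e\<in>arcs G. x e *\<^sub>R ((1 / 2) *\<^sub>R arc_vec e))" for x
    by (simp add: flow_vec_def)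
  show ?thesis
    unfolding cell_def slopes_def eq by (rule polytope_zonotope[OF finite_arcs])
qed

lemma cell_subset_H0: "cell g \<subseteq> H0"
  by (auto simp: cell_def H0_eq_orthogonal inner_flow_vec coboundary_def)

text \<open>The one-variable subgradient inequalities are added over the arcs with the lengths as
  weights. If the total is an equality, each nonnegative gap \<open>?d e\<close> vanishes, and every
  slope transfers from \<open>g\<close> to \<open>k\<close>.\<close>

lemma cell_subgradient:
  assumes "h \<in> cell g"
  shows "energy g + (k - g) \<bullet> h \<le> energy k"
    and "energy k = energy g + (k - g) \<bullet> h \<Longrightarrow> h \<in> cell k"
proof -
  obtain x where x: "\<And>e. e \<in> arcs G \<Longrightarrow> x e \<in> slopes (tension g e)" and h: "h = flow_vec x"
    using assms by (auto simp: cell_def)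
  let ?d = "\<lambda>e. interp_sq (tension k e) - interp_sq (tension g e) - x e * (tension k e - tension g e)"
  have d: "?d e \<ge> 0" if "e \<in> arcs G" for e
    using x[OF that, unfolded slopes_iff_subgradient, rule_format, of "tension k e"] by simp
  have "x e * coboundary G (k - g) e = of_int (l e) * (x e * (tension k e - tension g e))" if "e \<in> arcs G" for e
    using l_pos[OF that] by (simp add: tension_def coboundary_def field_simps)
  then have "(\<Sum>e\<in>arcs G. x e * coboundary G (k - g) e)
      = (\<Sum>e\<in>arcs G. of_int (l e) * (x e * (tension k e - tension g e)))"
    by (intro sum.cong refl) blast
  then have "(k - g) \<bullet> h = (\<Sum>e\<in>arcs G. of_int (l e) * (x e * (tension k e - tension g e))) / 2"
    by (simp add: h inner_flow_vec)
  then have eq: "energy k - energy g - (k - g) \<bullet> h = (\<Sum>e\<in>arcs G. of_int (l e) * ?d e) / 2"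
    by (simp only: energy_def sum_subtractf right_diff_distrib diff_divide_distrib)
  have nn: "0 \<le> of_int (l e) * ?d e" if "e \<in> arcs G" for e
    using d[OF that] l_pos[OF that] by (intro mult_nonneg_nonneg) auto
  then have "0 \<le> (\<Sum>e\<in>arcs G. of_int (l e) * ?d e)" by (rule sum_nonneg)
  with eq show "energy g + (k - g) \<bullet> h \<le> energy k" by linarith
  assume "energy k = energy g + (k - g) \<bullet> h"
  then have "(\<Sum>e\<in>arcs G. of_int (l e) * ?d e) = 0" using eq by linarith
  then have zero: "\<forall>e\<in>arcs G. of_int (l e) * ?d e = 0"
    using nn by (subst (asm) sum_nonneg_eq_0_iff[OF finite_arcs])
  have "x e \<in> slopes (tension k e)" if "e \<in> arcs G" for e
  proof (rule slopes_transfer[OF x[OF that]])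
    have "?d e = 0" using bspec[OF zero that] l_pos[OF that] by simp
    then show "interp_sq (tension k e) = interp_sq (tension g e) + x e * (tension k e - tension g e)"
      by linarith
  qed
  then show "h \<in> cell k" unfolding cell_def h by blast
qed

text \<open>The subgradient inequality from \<open>f\<close> to \<open>g\<close> defines a
  supporting half-space of \<open>cell f\<close>. Equality in it puts \<open>h\<close> into
  \<open>cell g\<close>, and the inequality from \<open>g\<close> to \<open>f\<close> gives the
  converse.\<close>

lemma cell_Int_face_of: "(cell f \<inter> cell g) face_of cell f"
proof -
  have "cell f \<inter> cell g = cell f \<inter> {h. (g - f) \<bullet> h = energy g - energy f}"
  proof (intro equalityI subsetI IntI CollectI)
    fix h assume "h \<in> cell f \<inter> cell g"
    then show "(g - f) \<bullet> h = energy g - energy f"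
      using cell_subgradient(1)[of h f g] cell_subgradient(1)[of h g f] by (simp add: inner_diff_left)
  qed (use cell_subgradient(2)[of _ f g] in auto)
  moreover have "\<dots> face_of cell f"
  proof (rule face_of_Int_supporting_hyperplane_le)
    show "(g - f) \<bullet> h \<le> energy g - energy f" if "h \<in> cell f" for h
      using cell_subgradient(1)[OF that, of g] by linarith
  qed (simp add: polytope_imp_convex polytope_cell)
  ultimately show ?thesis by simp
qed

section \<open>The polytopes \<open>VorH\<close> as subdifferentials at integer potentials\<close>

lemma tension_of_int_vec: "tension (of_int_vec f) e = of_int (twisted_diff G m f e) / of_int (l e)"
  by (simp add: tension_def coboundary_def of_int_vec_def twisted_diff_def)

lemma tension_Ints_iff:
  "e \<in> arcs G \<Longrightarrow> tension (of_int_vec f) e \<in> \<int> \<longleftrightarrow> l e dvd twisted_diff G m f e"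
  using l_pos[of e] by (auto simp: tension_of_int_vec of_int_div_of_int_in_Ints_iff)

lemma Gf_eq: "Gf G l m f = G\<lparr>arcs := {e \<in> arcs G. tension (of_int_vec f) e \<in> \<int>}\<rparr>"
  unfolding Gf_def using tension_Ints_iff by (intro arg_cong[where f = "\<lambda>A. G\<lparr>arcs := A\<rparr>"]) auto

lemma dd_eq:
  "e \<in> arcs G \<Longrightarrow> dd G l m f e =
     (if tension (of_int_vec f) e \<in> \<int> then tension (of_int_vec f) e
      else of_int \<lfloor>tension (of_int_vec f) e\<rfloor> + 1 / 2)"
  by (simp only: dd_def tension_Ints_iff) (simp only: tension_of_int_vec)

text \<open>For a non-integer \<open>u\<close>, \<open>floor (- u) = - floor u - 1\<close>; the
  added \<open>1 / 2\<close> is what makes the rounded value odd under reversal.\<close>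

lemma dd_in_C1: "dd G l m f \<in> C1 G arev"
proof -
  have "dd G l m f (arev e) = - dd G l m f e" if "e \<in> arcs G" for e
  proof -
    let ?u = "tension (of_int_vec f) e"
    have "\<lfloor>- ?u\<rfloor> = - \<lfloor>?u\<rfloor> - 1" if "?u \<notin> \<int>"
    proof -
      have "of_int \<lfloor>?u\<rfloor> \<noteq> ?u" using that by (metis Ints_of_int)
      then show ?thesis by (simp add: floor_minus ceiling_altdef)
    qed
    then show ?thesis using that by (simp add: dd_eq arev_arcs tension_arev)
  qed
  then show ?thesis by (simp add: C1_def)
qed

lemma box_cell_eq:
  "box_cell G arev l m f = {x \<in> C1 G arev. \<forall>e\<in>arcs G. x e \<in> slopes (tension (of_int_vec f) e)}"
proof (intro equalityI subsetI)
  fix x assume "x \<in> box_cell G arev l m f"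
  then obtain d where x: "x = (\<lambda>e. dd G l m f e + d e)" and d: "d \<in> C1 G arev"
    "\<forall>e\<in>arcs G. \<bar>d e\<bar> \<le> 1 / 2" "\<forall>e\<in>arcs G - arcs (Gf G l m f). d e = 0"
    by (auto simp: box_cell_def)
  have "x e \<in> slopes (tension (of_int_vec f) e)" if "e \<in> arcs G" for e
    unfolding abs_diff_le_half_iff_slopes[symmetric] dd_eq[OF that, symmetric] x
    using d that by (simp add: Gf_eq)
  moreover have "x \<in> C1 G arev" using d(1) dd_in_C1 by (auto simp: C1_def x)
  ultimately show "x \<in> {x \<in> C1 G arev. \<forall>e\<in>arcs G. x e \<in> slopes (tension (of_int_vec f) e)}" by auto
next
  fix x assume x: "x \<in> {x \<in> C1 G arev. \<forall>e\<in>arcs G. x e \<in> slopes (tension (of_int_vec f) e)}"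
  define d where "d = (\<lambda>e. x e - dd G l m f e)"
  have "\<bar>d e\<bar> \<le> 1 / 2" "tension (of_int_vec f) e \<notin> \<int> \<longrightarrow> d e = 0" if "e \<in> arcs G" for e
    using x abs_diff_le_half_iff_slopes[of "x e" "tension (of_int_vec f) e"] that
    unfolding d_def dd_eq[OF that] by blast+
  moreover have "d \<in> C1 G arev" using x dd_in_C1 by (auto simp: C1_def d_def)
  moreover have "x = (\<lambda>e. dd G l m f e + d e)" by (simp add: d_def)
  ultimately show "x \<in> box_cell G arev l m f" unfolding box_cell_def by (auto simp: Gf_eq)
qed

lemma VorH_eq_cell: "VorH G arev l m f = cell (of_int_vec f)"
proof (intro equalityI subsetI)
  fix h assume "h \<in> VorH G arev l m f"
  then show "h \<in> cell (of_int_vec f)"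
    by (auto simp: VorH_def box_cell_eq cell_def flow_vec_eq_coboundary_adj[symmetric])
next
  fix h assume "h \<in> cell (of_int_vec f)"
  then obtain x where x: "\<forall>e\<in>arcs G. x e \<in> slopes (tension (of_int_vec f) e)" and h: "h = flow_vec x"
    by (auto simp: cell_def)
  \<comment> \<open>The antisymmetric part stays admissible because the slope intervals are convex
    and change sign under reversal.\<close>
  let ?y = "\<lambda>e. (x e - x (arev e)) / 2"
  have "?y e \<in> slopes (tension (of_int_vec f) e)" if "e \<in> arcs G" for e
  proof -
    have "x (arev e) \<in> slopes (- tension (of_int_vec f) e)"
      using x that by (metis arev_arcs tension_arev)
    then have "- x (arev e) \<in> slopes (tension (of_int_vec f) e)" 
      using slopes_uminus[of "- x (arev e)"] by simp
    with x that show ?thesis by (force simp: slopes_def)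
  qed
  moreover have y: "?y \<in> C1 G arev" by (auto simp: C1_def arev_arev field_simps)
  ultimately have "?y \<in> box_cell G arev l m f" by (simp add: box_cell_eq)
  moreover have "h = coboundary_adj G ?y"
    unfolding h by (subst flow_vec_eq_coboundary_adj[OF y, symmetric]) (rule flow_vec_antisymmetrise[symmetric])
  ultimately show "h \<in> VorH G arev l m f" unfolding VorH_def by (intro image_eqI)
qed

subsection \<open>The Laplacian\<close>

lemma laplacian_eq_flow_vec: "laplacian G g = flow_vec (coboundary G g)" for g :: "real ^ 'v"
  unfolding laplacian_def
  by (rule flow_vec_eq_coboundary_adj[symmetric]) (simp add: C1_def coboundary_def tail_arev head_arev)

lemma inner_laplacian:
  fixes g k :: "real ^ 'v"
  shows "g \<bullet> laplacian G k = (\<Sum>e\<in>arcs G. coboundary G g e * coboundary G k e) / 2"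
  by (simp add: laplacian_eq_flow_vec inner_flow_vec mult.commute)

lemma inner_laplacian_commute: "g \<bullet> laplacian G k = k \<bullet> laplacian G g" for g k :: "real ^ 'v"
  by (simp add: inner_laplacian mult.commute)

lemma linear_laplacian: "linear (laplacian G :: real ^ 'v \<Rightarrow> real ^ 'v)"
  by (intro linearI) (simp_all add: laplacian_def coboundary_adj_def coboundary_def vec_eq_iff
      sum.distrib sum_subtractf sum_distrib_left algebra_simps)

lemma laplacian_in_H0: "laplacian G g \<in> H0" for g :: "real ^ 'v"
  by (simp add: H0_eq_orthogonal laplacian_eq_flow_vec inner_flow_vec) (simp add: coboundary_def)

lemma const_of_coboundary_zero:
  fixes g :: "'a::ab_group_add ^ 'v"
  assumes "Digraph_Component.connected G" "\<And>e. e \<in> arcs G \<Longrightarrow> coboundary G g e = 0"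
  shows "g $ u = g $ v"
proof -
  have "{w. g $ w = g $ v} = UNIV"
  proof (rule ccontr)
    assume "{w. g $ w = g $ v} \<noteq> UNIV"
    then obtain e where "e \<in> arcs G" "(g $ tail G e = g $ v) \<noteq> (g $ head G e = g $ v)"
      using assms(1)[unfolded connected_iff_cut[OF verts], rule_format, of "{w. g $ w = g $ v}"] by auto
    with assms(2)[of e] show False by (simp add: coboundary_def)
  qed
  then show ?thesis by auto
qed

lemma laplacian_kernel_H0:
  assumes "Digraph_Component.connected G" "laplacian G g = 0" "g \<in> H0"
  shows "g = 0"
proof -
  have "(\<Sum>e\<in>arcs G. coboundary G g e * coboundary G g e) = 0"
    using inner_laplacian[of g g] assms(2) by simp
  then have "coboundary G g e = 0" if "e \<in> arcs G" for e
    using that by (subst (asm) sum_nonneg_eq_0_iff) (auto simp: finite_arcs)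
  then have const: "g $ u = g $ v" for u v using const_of_coboundary_zero assms(1) by blast
  have "g $ v = 0" for v
  proof -
    have "0 = (\<Sum>u\<in>UNIV. g $ u)" using assms(3) by (simp add: H0_def)
    also have "\<dots> = (\<Sum>u::'v\<in>UNIV. g $ v)" by (intro sum.cong refl const)
    also have "\<dots> = real CARD('v) * g $ v" by simp
    finally show ?thesis by simp
  qed
  then show ?thesis by (subst vec_eq_iff) simp
qed

text \<open>The Laplacian maps \<open>H0\<close> into itself injectively, hence onto by comparing
  dimensions.\<close>

lemma laplacian_surj_H0:
  assumes "Digraph_Component.connected G" "h \<in> H0"
  obtains g where "g \<in> H0" "laplacian G g = h"
proof -
  let ?L = "laplacian G :: real ^ 'v \<Rightarrow> real ^ 'v"
  have "span H0 = (H0 :: (real ^ 'v) set)" using subspace_H0 by (simp only: span_eq_iff)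
  moreover have "inj_on ?L H0"
    using linear_inj_on_iff_eq_0[OF linear_laplacian subspace_H0]
      laplacian_kernel_H0[OF assms(1)] by simp
  ultimately have "inj_on ?L (span H0)" by metis
  then have "dim (?L ` H0) = dim (H0 :: (real ^ 'v) set)"
    by (rule dim_image_eq[OF linear_laplacian])
  then have "?L ` H0 = H0"
    by (intro subspace_dim_equal linear_subspace_image linear_laplacian subspace_H0)
      (auto simp: laplacian_in_H0)
  then obtain g where "g \<in> H0" "laplacian G g = h" using assms(2) by (metis imageE)
  then show ?thesis by (rule that)
qed

text \<open>An injective linear map on a finite-dimensional subspace is bounded below; the Laplacian
  is such a map on \<open>H0\<close>, and its norm is at most the sum of the absolute differences
  along the arcs.\<close>

lemma coboundary_lower_bound:
  assumes "Digraph_Component.connected G"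
  obtains c where "c > 0" "\<And>g :: real ^ 'v. g \<in> H0 \<Longrightarrow> c * norm g \<le> (\<Sum>e\<in>arcs G. \<bar>coboundary G g e\<bar>)"
proof -
  have "\<exists>c>0. \<forall>g\<in>H0. norm (laplacian G g) \<ge> c * norm (g :: real ^ 'v)"
    by (rule injective_imp_isometric)
      (auto simp: closed_subspace subspace_H0 linear_conv_bounded_linear[symmetric] linear_laplacian
        intro: laplacian_kernel_H0[OF assms])
  then obtain c where c: "c > 0" "\<And>g. g \<in> H0 \<Longrightarrow> c * norm (g :: real ^ 'v) \<le> norm (laplacian G g)"
    by blast
  have "norm (laplacian G g) \<le> (\<Sum>e\<in>arcs G. \<bar>coboundary G g e\<bar>)" for g :: "real ^ 'v"
    unfolding laplacian_def coboundary_adj_eq_sum by (rule sum_norm_le) simp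
  with c(2) have "c * norm g \<le> (\<Sum>e\<in>arcs G. \<bar>coboundary G g e\<bar>)" if "g \<in> H0" for g :: "real ^ 'v"
    using that order_trans by blast
  with c(1) that show ?thesis by blast
qed

subsection \<open>Covering by subdifferentials\<close>

lemma tension_add_const: "tension (g + c *\<^sub>R 1) = tension g"
  by (rule ext) (simp add: tension_def coboundary_def)

lemma energy_add_const: "energy (g + c *\<^sub>R 1) = energy g"
  by (simp add: energy_def tension_add_const)

lemma cell_add_const: "cell (g + c *\<^sub>R 1) = cell g"
  by (simp add: cell_def tension_add_const)

lemma continuous_on_energy: "continuous_on A energy"
proof -
  have "continuous_on A (\<lambda>g. interp_sq (tension g e))" for e
    by (rule continuous_on_compose2[OF continuous_on_interp_sq[of UNIV]])
      (auto simp: tension_def coboundary_def divide_inverse intro!: continuous_intros)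
  then show ?thesis unfolding energy_def by (intro continuous_intros) auto
qed

lemma energy_coercive:
  assumes "Digraph_Component.connected G"
  obtains K where "\<And>g. g \<in> H0 \<Longrightarrow> norm g - K \<le> energy g - g \<bullet> h"
proof -
  obtain c where c: "c > 0" "\<And>g :: real ^ 'v. g \<in> H0 \<Longrightarrow> c * norm g \<le> (\<Sum>e\<in>arcs G. \<bar>coboundary G g e\<bar>)"
    using coboundary_lower_bound[OF assms] by blast
  \<comment> \<open>This choice gives \<open>M / 2 * c = norm h + 1\<close>: the part
    \<open>norm h\<close> absorbs \<open>g \<bullet> h\<close> by Cauchy-Schwarz, and
    \<open>norm g\<close> is left over. \<open>K\<close> collects the error terms from the twist and
    from \<open>M * \<bar>u\<bar> - M^2 / 2 \<le> u^2 / 2\<close>.\<close>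
  define M where "M = 2 * (norm h + 1) / c"
  define K where "K = (\<Sum>e\<in>arcs G. M * \<bar>of_int (m e)\<bar> + of_int (l e) * (M\<^sup>2 / 2)) / 2"
  have M: "M \<ge> 0" using c by (simp add: M_def)
  have "norm g - K \<le> energy g - g \<bullet> h" if g: "g \<in> H0" for g
  proof -
    have arc: "M * \<bar>coboundary G g e\<bar> - (M * \<bar>of_int (m e)\<bar> + of_int (l e) * (M\<^sup>2 / 2))
        \<le> of_int (l e) * interp_sq (tension g e)" if "e \<in> arcs G" for e
    proof -
      let ?u = "tension g e"
      have lpos: "0 < real_of_int (l e)" using l_pos[OF that] by simp
      have "0 \<le> (\<bar>?u\<bar> - M)\<^sup>2" by simp
      then have "M * \<bar>?u\<bar> - M\<^sup>2 / 2 \<le> interp_sq ?u"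
        using interp_sq_ge_sq[of ?u] by (simp add: power2_diff algebra_simps)
      then have "of_int (l e) * (M * \<bar>?u\<bar> - M\<^sup>2 / 2) \<le> of_int (l e) * interp_sq ?u"
        using lpos by (intro mult_left_mono) auto
      moreover have "of_int (l e) * \<bar>?u\<bar> = \<bar>coboundary G g e + of_int (m e)\<bar>"
        using lpos by (simp add: tension_def abs_divide)
      then have "of_int (l e) * (M * \<bar>?u\<bar> - M\<^sup>2 / 2)
          = M * \<bar>coboundary G g e + of_int (m e)\<bar> - of_int (l e) * (M\<^sup>2 / 2)"
        unfolding right_diff_distrib mult.left_commute[of "of_int (l e)" M] by simp
      moreover have "M * (\<bar>coboundary G g e\<bar> - \<bar>of_int (m e)\<bar>) \<le> M * \<bar>coboundary G g e + of_int (m e)\<bar>"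
        using M by (intro mult_left_mono) auto
      ultimately show ?thesis unfolding right_diff_distrib by linarith
    qed
    have "(M / 2) * (\<Sum>e\<in>arcs G. \<bar>coboundary G g e\<bar>) - K
        = (\<Sum>e\<in>arcs G. M * \<bar>coboundary G g e\<bar> - (M * \<bar>of_int (m e)\<bar> + of_int (l e) * (M\<^sup>2 / 2))) / 2"
      unfolding K_def sum_subtractf sum_distrib_left diff_divide_distrib sum_divide_distrib by simp
    also have "\<dots> \<le> energy g"
      unfolding energy_def using arc by (intro divide_right_mono sum_mono) auto
    finally have 1: "(M / 2) * (\<Sum>e\<in>arcs G. \<bar>coboundary G g e\<bar>) - K \<le> energy g" .
    have "(M / 2) * (c * norm g) \<le> (M / 2) * (\<Sum>e\<in>arcs G. \<bar>coboundary G g e\<bar>)"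
      using M c(2)[OF g] by (intro mult_left_mono) auto
    moreover have "(M / 2) * (c * norm g) = (norm h + 1) * norm g" using c(1) by (simp add: M_def)
    moreover have "g \<bullet> h \<le> norm g * norm h" by (rule norm_cauchy_schwarz)
    ultimately show ?thesis using 1 by (simp add: algebra_simps)
  qed
  then show ?thesis by (rule that)
qed

lemma energy_minimiser:
  assumes "Digraph_Component.connected G" "h \<in> H0"
  obtains g where "\<And>k. energy g - g \<bullet> h \<le> energy k - k \<bullet> h"
proof -
  let ?\<Phi> = "\<lambda>g. energy g - g \<bullet> h"
  obtain K where K: "\<And>g. g \<in> H0 \<Longrightarrow> norm g - K \<le> ?\<Phi> g"
    using energy_coercive[OF assms(1)] by blast
  \<comment> \<open>On \<open>H0\<close> outside this ball, coercivity makes the objective larger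
    than its value at \<open>0\<close>, while the maximum with \<open>0\<close> keeps the origin
    inside.\<close>
  define B :: "(real ^ 'v) set" where "B = H0 \<inter> cball 0 (max 0 (K + ?\<Phi> 0))"
  have "compact B" unfolding B_def
    by (intro closed_Int_compact closed_subspace subspace_H0 compact_cball)
  moreover have zero: "0 \<in> B" by (simp add: B_def subspace_0 subspace_H0)
  moreover have "continuous_on B ?\<Phi>" by (intro continuous_intros continuous_on_energy)
  ultimately obtain g where g: "\<And>k. k \<in> B \<Longrightarrow> ?\<Phi> g \<le> ?\<Phi> k"
    using continuous_attains_inf[of B ?\<Phi>] by blast
  have "?\<Phi> g \<le> ?\<Phi> k" for k
  proof -
    obtain c where c: "k + c *\<^sub>R 1 \<in> H0" using H0_projection .
    have "?\<Phi> g \<le> ?\<Phi> (k + c *\<^sub>R 1)"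
    proof (cases "k + c *\<^sub>R 1 \<in> B")
      case False
      then have "K + ?\<Phi> 0 < norm (k + c *\<^sub>R 1)" using c by (auto simp: B_def)
      then show ?thesis using K[OF c] g[OF zero] by linarith
    qed (rule g)
    also have "\<dots> = ?\<Phi> k"
      using assms(2) by (simp add: energy_add_const inner_add_left H0_eq_orthogonal)
    finally show ?thesis .
  qed
  then show ?thesis by (rule that)
qed

text \<open>Each arc supplies a slope for its one-sided derivative, and finitely many arcs share an
  interval of small \<open>t\<close>. Thus the directional derivative is attained by a point of the
  subdifferential.\<close>

lemma energy_locally_linear:
  "\<exists>p\<in>cell g. \<forall>\<^sub>F t in at_right 0. energy (g + t *\<^sub>R k) = energy g + t * (k \<bullet> p)"
proof -
  have "\<exists>s\<in>slopes (tension g e). \<forall>\<^sub>F t in at_right 0.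
      interp_sq (tension g e + t * (coboundary G k e / of_int (l e)))
      = interp_sq (tension g e) + t * (s * (coboundary G k e / of_int (l e)))" for e
    by (rule interp_sq_locally_linear)
  then have "\<forall>e. \<exists>s. s \<in> slopes (tension g e) \<and> (\<forall>\<^sub>F t in at_right 0.
      interp_sq (tension g e + t * (coboundary G k e / of_int (l e)))
      = interp_sq (tension g e) + t * (s * (coboundary G k e / of_int (l e))))" by blast
  from choice[OF this] obtain x where x: "\<And>e. x e \<in> slopes (tension g e)"
    and lin: "\<And>e. \<forall>\<^sub>F t in at_right 0. interp_sq (tension g e + t * (coboundary G k e / of_int (l e)))
      = interp_sq (tension g e) + t * (x e * (coboundary G k e / of_int (l e)))"
    by blast
  have tens: "tension (g + t *\<^sub>R k) e = tension g e + t * (coboundary G k e / of_int (l e))" for t e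
    by (simp add: tension_add) (simp add: coboundary_def right_diff_distrib)
  have "\<forall>\<^sub>F t in at_right 0. \<forall>e\<in>arcs G. interp_sq (tension (g + t *\<^sub>R k) e)
      = interp_sq (tension g e) + t * (x e * (coboundary G k e / of_int (l e)))"
    using lin by (intro eventually_ball_finite finite_arcs) (simp add: tens)
  then have "\<forall>\<^sub>F t in at_right 0. energy (g + t *\<^sub>R k) = energy g + t * (k \<bullet> flow_vec x)"
  proof (rule eventually_mono)
    fix t :: real
    assume t: "\<forall>e\<in>arcs G. interp_sq (tension (g + t *\<^sub>R k) e)
      = interp_sq (tension g e) + t * (x e * (coboundary G k e / of_int (l e)))"
    have "(\<Sum>e\<in>arcs G. of_int (l e) * interp_sq (tension (g + t *\<^sub>R k) e))
      = (\<Sum>e\<in>arcs G. of_int (l e) * interp_sq (tension g e) + t * (x e * coboundary G k e))"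
    proof (rule sum.cong[OF refl])
      fix e assume e: "e \<in> arcs G"
      show "of_int (l e) * interp_sq (tension (g + t *\<^sub>R k) e)
        = of_int (l e) * interp_sq (tension g e) + t * (x e * coboundary G k e)"
        using t[rule_format, OF e] l_pos[OF e] by (simp add: distrib_left)
    qed
    then show "energy (g + t *\<^sub>R k) = energy g + t * (k \<bullet> flow_vec x)"
      by (simp add: energy_def inner_flow_vec sum.distrib sum_distrib_left[symmetric] add_divide_distrib)
  qed
  then show ?thesis using x unfolding cell_def by blast
qed

text \<open>At a minimiser \<open>g\<close> of \<open>energy g - g \<bullet> h\<close>, a hyperplane
  with normal \<open>a\<close> separating \<open>h\<close> from \<open>cell g\<close> would make the
  objective decrease in direction \<open>- a\<close>.\<close>

lemma H0_subset_cells: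
  assumes "Digraph_Component.connected G" "h \<in> H0"
  obtains g where "h \<in> cell g"
proof -
  obtain g where g: "\<And>k. energy g - g \<bullet> h \<le> energy k - k \<bullet> h"
    using energy_minimiser[OF assms] by blast
  have "h \<in> cell g"
  proof (rule ccontr)
    assume "h \<notin> cell g"
    then obtain a b where ab: "a \<bullet> h < b" "\<And>p. p \<in> cell g \<Longrightarrow> b < a \<bullet> p"
      using separating_hyperplane_closed_point[of "cell g" h] polytope_cell[of g]
        polytope_imp_convex polytope_imp_closed by blast
    obtain p where p: "p \<in> cell g"
      and ev: "\<forall>\<^sub>F t in at_right 0. energy (g + t *\<^sub>R (- a)) = energy g + t * ((- a) \<bullet> p)"
      using energy_locally_linear[of g "- a"] by blast
    have "\<forall>\<^sub>F t in at_right 0. (0::real) < t \<and> energy (g + t *\<^sub>R (- a)) = energy g + t * ((- a) \<bullet> p)"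
      by (intro eventually_conj ev eventually_at_right_less)
    from eventually_happens'[OF trivial_limit_at_right_real this]
    obtain t where t: "0 < t" "energy (g + t *\<^sub>R (- a)) = energy g + t * ((- a) \<bullet> p)" by blast
    have "a \<bullet> h < a \<bullet> p" using ab(1) ab(2)[OF p] by linarith
    then have "t * (a \<bullet> h) < t * (a \<bullet> p)" using t(1) by simp
    moreover have "energy g - g \<bullet> h \<le> energy g + t * ((- a) \<bullet> p) - (g + t *\<^sub>R (- a)) \<bullet> h"
      using g[of "g + t *\<^sub>R (- a)"] t(2) by simp
    ultimately show False by (simp add: inner_diff_left)
  qed
  then show ?thesis by (rule that)
qed

section \<open>From real to integer potentials by sliding along cuts\<close>

definition integral_arcs :: "real ^ 'v \<Rightarrow> 'e set" where
  "integral_arcs g = {e \<in> arcs G. tension g e \<in> \<int>}"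

lemma finite_integral_arcs: "finite (integral_arcs g)"
  using finite_arcs by (simp add: integral_arcs_def)

text \<open>Raising the potential on one side of a cut that avoids the integral arcs until the first
  crossing arc becomes integral stays inside one linear piece of the energy, so subgradients persist.\<close>

lemma enlarge_integral_arcs:
  assumes conn: "Digraph_Component.connected G" and h: "h \<in> cell g"
    and not_conn: "\<not> Digraph_Component.connected (G\<lparr>arcs := integral_arcs g\<rparr>)"
  obtains g' where "h \<in> cell g'" "integral_arcs g \<subset> integral_arcs g'"
proof -
  have "\<exists>S. S \<noteq> {} \<and> S \<noteq> UNIV \<and> (\<forall>e\<in>integral_arcs g. (tail G e \<in> S) = (head G e \<in> S))"
    using not_conn connected_iff_cut[of "G\<lparr>arcs := integral_arcs g\<rparr>"] verts by auto
  then obtain S where S: "S \<noteq> {}" "S \<noteq> UNIV"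
    and no_cross: "\<And>e. e \<in> integral_arcs g \<Longrightarrow> (tail G e \<in> S) = (head G e \<in> S)" by blast
  \<comment> \<open>Only crossing arcs directed into \<open>S\<close> are recorded: their tensions
    rise, and the opposite arcs follow by reversal.\<close>
  define C where "C = {e \<in> arcs G. tail G e \<notin> S \<and> head G e \<in> S}"
  obtain e1 where e1: "e1 \<in> arcs G" "(tail G e1 \<in> S) \<noteq> (head G e1 \<in> S)"
    using conn S unfolding connected_iff_cut[OF verts] by blast
  have "e1 \<in> C \<or> arev e1 \<in> C" using e1 by (auto simp: C_def arev_arcs tail_arev head_arev)
  then have C: "C \<noteq> {}" "finite C" using finite_arcs by (auto simp: C_def)
  \<comment> \<open>The gap is the increase of potential on \<open>S\<close> that brings the tension
    of \<open>e\<close> to the next integer. It is positive since no crossing arc is integral, and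
    the least gap \<open>t\<close> stops at the first arc to become integral.\<close>
  define gap where "gap e = of_int (l e) * (of_int \<lceil>tension g e\<rceil> - tension g e)" for e
  define t where "t = Min (gap ` C)"
  have gap_pos: "0 < gap e" if "e \<in> C" for e
  proof -
    have "e \<in> arcs G" using that by (simp add: C_def)
    moreover have "tension g e \<notin> \<int>"
      using no_cross[of e] that by (auto simp: integral_arcs_def C_def)
    then have "tension g e \<noteq> of_int \<lceil>tension g e\<rceil>" by (metis Ints_of_int)
    then have "tension g e < of_int \<lceil>tension g e\<rceil>" using le_of_int_ceiling[of "tension g e"] by linarith
    ultimately show ?thesis using l_pos[of e] by (simp add: gap_def)
  qed
  have t_pos: "0 < t" unfolding t_def using C gap_pos by (subst Min_gr_iff) auto
  have t_le: "t \<le> gap e" if "e \<in> C" for e unfolding t_def using C that by simp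
  have "t \<in> gap ` C" unfolding t_def using C by (intro Min_in) auto
  then obtain e0 where e0: "e0 \<in> C" "gap e0 = t" by auto
  define g' where "g' = g + (\<chi> v. if v \<in> S then t else 0)"
  have same: "tension g' e = tension g e" if "(tail G e \<in> S) = (head G e \<in> S)" for e
    using that by (simp add: g'_def tension_add coboundary_def)
  have up: "tension g' e = tension g e + t / of_int (l e)" if "e \<in> C" for e
    using that by (simp add: g'_def tension_add coboundary_def C_def)
  have mono_C: "slopes (tension g e) \<subseteq> slopes (tension g' e)" if "e \<in> C" for e
  proof (rule slopes_mono)
    have lpos: "0 < real_of_int (l e)" using l_pos[of e] that by (simp add: C_def)
    show "tension g e < tension g' e" using t_pos lpos by (simp add: up[OF that])
    show "tension g' e \<le> of_int \<lceil>tension g e\<rceil>"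
      using t_le[OF that] lpos by (simp add: up[OF that] gap_def field_simps)
  qed
  have mono: "slopes (tension g e) \<subseteq> slopes (tension g' e)" if e: "e \<in> arcs G" for e
  proof -
    consider "(tail G e \<in> S) = (head G e \<in> S)" | "e \<in> C" | "arev e \<in> C"
      using e by (auto simp: C_def arev_arcs tail_arev head_arev)
    then show ?thesis
    proof cases
      case 1
      then show ?thesis by (simp add: same)
    next
      case 2
      then show ?thesis by (rule mono_C)
    next
      case 3
      show ?thesis
      proof
        fix s assume "s \<in> slopes (tension g e)"
        then have "- s \<in> slopes (tension g (arev e))"
          using slopes_uminus[of s "tension g e"] e by (simp add: tension_arev)
        then have "- s \<in> slopes (tension g' (arev e))" using mono_C[OF 3] by blast
        then show "s \<in> slopes (tension g' e)"
          using slopes_uminus[of s "tension g' e"] e by (simp add: tension_arev)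
      qed
    qed
  qed
  have "h \<in> cell g'" using h mono unfolding cell_def by blast
  moreover have "integral_arcs g \<subseteq> integral_arcs g'"
    using no_cross same by (auto simp: integral_arcs_def)
  moreover have "e0 \<in> integral_arcs g'"
  proof -
    have "e0 \<in> arcs G" using e0 by (simp add: C_def)
    then have "tension g' e0 = of_int \<lceil>tension g e0\<rceil>"
      using up[OF e0(1)] e0(2)[symmetric] l_pos[of e0] by (simp add: gap_def)
    then show ?thesis using \<open>e0 \<in> arcs G\<close> by (simp add: integral_arcs_def)
  qed
  moreover have "e0 \<notin> integral_arcs g" using e0(1) no_cross[of e0] by (auto simp: C_def)
  ultimately show ?thesis using that[of g'] by blast
qed

lemma integral_potential:
  assumes "Digraph_Component.connected (G\<lparr>arcs := integral_arcs g\<rparr>)"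
  obtains f :: "int ^ 'v" and c where "of_int_vec f = g + c *\<^sub>R 1"
proof -
  obtain v0 :: 'v where True by simp
  \<comment> \<open>Along an integral arc the potential changes by the integer
    \<open>l e * tension g e - m e\<close>, so no integral arc crosses this set.\<close>
  define S where "S = {v. g $ v - g $ v0 \<in> \<int>}"
  have "S = UNIV"
  proof (rule ccontr)
    assume "S \<noteq> UNIV"
    moreover have "v0 \<in> S" by (simp add: S_def)
    ultimately obtain e where e: "e \<in> integral_arcs g" "(tail G e \<in> S) \<noteq> (head G e \<in> S)"
      using assms connected_iff_cut[of "G\<lparr>arcs := integral_arcs g\<rparr>"] verts by auto
    have "coboundary G g e = of_int (l e) * tension g e - of_int (m e)"
      using e(1) l_pos[of e] by (simp add: tension_def integral_arcs_def)
    then have d: "g $ head G e - g $ tail G e \<in> \<int>"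
      using e(1) by (simp add: integral_arcs_def coboundary_def)
    have "g $ head G e - g $ v0 \<in> \<int>" if "g $ tail G e - g $ v0 \<in> \<int>"
      using Ints_add[OF d that] by simp
    moreover have "g $ tail G e - g $ v0 \<in> \<int>" if "g $ head G e - g $ v0 \<in> \<int>"
      using Ints_diff[OF that d] by simp
    ultimately show False using e(2) by (auto simp: S_def)
  qed
  then have int: "of_int \<lfloor>g $ v - g $ v0\<rfloor> = g $ v - g $ v0" for v
    by (auto simp: S_def elim!: Ints_cases)
  have "of_int_vec (\<chi> v. \<lfloor>g $ v - g $ v0\<rfloor>) = g + (- (g $ v0)) *\<^sub>R 1"
    by (simp add: of_int_vec_def vec_eq_iff int)
  then show ?thesis by (rule that)
qed

lemma H0_covered:
  assumes "Digraph_Component.connected G" "h \<in> H0"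
  obtains f where "Digraph_Component.connected (Gf G l m f)" "h \<in> cell (of_int_vec f)"
proof -
  obtain g0 where g0: "h \<in> cell g0" using H0_subset_cells[OF assms] .
  \<comment> \<open>The bound permits choosing, among all potentials whose cell contains
    \<open>h\<close>, one with the most integral arcs; it cannot be enlarged further.\<close>
  have "\<forall>g. h \<in> cell g \<longrightarrow> card (integral_arcs g) < Suc (card (arcs G))"
    using finite_arcs by (auto simp: integral_arcs_def less_Suc_eq_le intro!: card_mono)
  from ex_has_greatest_nat[of "\<lambda>g. h \<in> cell g", OF g0 this] obtain g where g: "h \<in> cell g"
    and max: "\<And>k. h \<in> cell k \<Longrightarrow> card (integral_arcs k) \<le> card (integral_arcs g)" by blast
  have conn: "Digraph_Component.connected (G\<lparr>arcs := integral_arcs g\<rparr>)"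
  proof (rule ccontr)
    assume "\<not> ?thesis"
    then obtain g' where "h \<in> cell g'" "integral_arcs g \<subset> integral_arcs g'"
      using enlarge_integral_arcs[OF assms(1) g] by blast
    then show False
      using max[of g'] psubset_card_mono[OF finite_integral_arcs, of "integral_arcs g" g'] by linarith
  qed
  then obtain f c where f: "of_int_vec f = g + c *\<^sub>R 1" using integral_potential by blast
  have "Gf G l m f = G\<lparr>arcs := integral_arcs g\<rparr>"
    by (simp add: Gf_eq f tension_add_const integral_arcs_def)
  with conn g show ?thesis using that[of f] by (simp add: f cell_add_const)
qed

subsection \<open>Comparison with Voronoi cells\<close>

lemma metric_graph_Gf: "metric_graph (Gf G l m f) arev (\<lambda>_. 1) (\<lambda>_. 0)"
  by unfold_locales
    (auto simp: Gf_eq finite_arcs verts arev_arcs arev_arev tail_arev tension_arev)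

text \<open>The perturbation around \<open>dd\<close> lives on the arcs of \<open>Gf\<close>, and on
  that graph with unit lengths, zero twist and zero potential the centre of the box is
  \<open>0\<close>.\<close>

lemma VorH_translate:
  "VorH G arev l m f = (+) (coboundary_adj G (dd G l m f)) ` VorH (Gf G l m f) arev (\<lambda>_. 1) (\<lambda>_. 0) 0"
proof -
  let ?H = "Gf G l m f"
  have arcs_H: "arcs ?H = {e \<in> arcs G. tension (of_int_vec f) e \<in> \<int>}"
    and [simp]: "head ?H = head G" by (simp_all add: Gf_eq)
  have box_H: "box_cell ?H arev (\<lambda>_. 1) (\<lambda>_. 0) 0 = {d \<in> C1 ?H arev. \<forall>e\<in>arcs ?H. \<bar>d e\<bar> \<le> 1 / 2}"
    by (auto simp: box_cell_def dd_def twisted_diff_def Gf_def)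
  have eq: "coboundary_adj G (\<lambda>e. dd G l m f e + d e) = coboundary_adj G (dd G l m f) + coboundary_adj ?H d"
    if "\<forall>e\<in>arcs G - arcs ?H. d e = 0" for d
  proof -
    have "(\<Sum>e | e \<in> arcs G \<and> head G e = v. d e) = (\<Sum>e | e \<in> arcs ?H \<and> head G e = v. d e)" for v
      using that finite_arcs by (intro sum.mono_neutral_right) (auto simp: arcs_H)
    then show ?thesis by (simp add: coboundary_adj_def vec_eq_iff sum.distrib)
  qed
  show ?thesis
  proof (intro equalityI subsetI)
    fix h assume "h \<in> VorH G arev l m f"
    then obtain d where d: "d \<in> C1 G arev" "\<forall>e\<in>arcs G. \<bar>d e\<bar> \<le> 1 / 2" "\<forall>e\<in>arcs G - arcs ?H. d e = 0"
      and h: "h = coboundary_adj G (\<lambda>e. dd G l m f e + d e)"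
      by (auto simp: VorH_def box_cell_def)
    have "d \<in> box_cell ?H arev (\<lambda>_. 1) (\<lambda>_. 0) 0"
      using d by (auto simp: box_H C1_def arcs_H)
    then show "h \<in> (+) (coboundary_adj G (dd G l m f)) ` VorH ?H arev (\<lambda>_. 1) (\<lambda>_. 0) 0"
      unfolding h eq[OF d(3)] VorH_def by blast
  next
    fix h assume "h \<in> (+) (coboundary_adj G (dd G l m f)) ` VorH ?H arev (\<lambda>_. 1) (\<lambda>_. 0) 0"
    then obtain d where d: "d \<in> C1 ?H arev" "\<forall>e\<in>arcs ?H. \<bar>d e\<bar> \<le> 1 / 2"
      and h: "h = coboundary_adj G (dd G l m f) + coboundary_adj ?H d"
      by (auto simp: VorH_def box_H)
    define d' where "d' e = (if e \<in> arcs ?H then d e else 0)" for e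
    have "d' \<in> C1 G arev" "\<forall>e\<in>arcs G. \<bar>d' e\<bar> \<le> 1 / 2" and d'0: "\<forall>e\<in>arcs G - arcs ?H. d' e = 0"
      using d by (auto simp: C1_def d'_def arcs_H arev_arcs tension_arev)
    then have "(\<lambda>e. dd G l m f e + d' e) \<in> box_cell G arev l m f" by (auto simp: box_cell_def)
    moreover have "coboundary_adj ?H d = coboundary_adj ?H d'"
      by (auto simp: coboundary_adj_def vec_eq_iff d'_def intro!: sum.cong)
    then have "h = coboundary_adj G (\<lambda>e. dd G l m f e + d' e)" by (simp add: h eq[OF d'0])
    ultimately show "h \<in> VorH G arev l m f" unfolding VorH_def by (intro image_eqI)
  qed
qed

text \<open>Symmetry of the Laplacian shows that the value does not depend on the chosen preimage,
  so the definite description is well defined.\<close>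

lemma laplacian_form_laplacian: "laplacian_form G (laplacian G g) = g \<bullet> laplacian G g"
  unfolding laplacian_form_def
proof (rule the_equality)
  fix r assume "\<exists>f. laplacian G f = laplacian G g \<and> r = f \<bullet> laplacian G f"
  then obtain f where f: "laplacian G f = laplacian G g" "r = f \<bullet> laplacian G f" by blast
  then have "r = f \<bullet> laplacian G g" by simp
  also have "\<dots> = g \<bullet> laplacian G f" by (rule inner_laplacian_commute)
  finally show "r = g \<bullet> laplacian G g" using f(1) by simp
qed blast

lemma of_int_vec_laplacian: "of_int_vec (laplacian G f) = laplacian G (of_int_vec f)"
  by (simp add: of_int_vec_def laplacian_def coboundary_adj_def coboundary_def vec_eq_iff)

end

section \<open>Unit lengths and zero twist: the Voronoi cell of the origin\<close>

locale unit_graph = metric_graph G arev "\<lambda>_. 1" "\<lambda>_. 0"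
  for G :: "('v::finite, 'e) pre_digraph" and arev :: "'e \<Rightarrow> 'e"
begin

text \<open>All tensions of an integer potential are integers here, where the interpolation is
  exact.\<close>

lemma energy_of_int_vec: "energy (of_int_vec z) = (of_int_vec z \<bullet> laplacian G (of_int_vec z)) / 2"
proof -
  have "of_int 1 * interp_sq (tension (of_int_vec z) e)
      = (coboundary G (of_int_vec z) e * coboundary G (of_int_vec z) e) / 2" for e
  proof -
    have "tension (of_int_vec z) e = of_int (coboundary G z e)"
      "coboundary G (of_int_vec z) e = (of_int (coboundary G z e) :: real)"
      by (simp_all add: tension_def coboundary_def of_int_vec_def)
    then show ?thesis by (simp add: power2_eq_square)
  qed
  then show ?thesis unfolding energy_def inner_laplacian by (simp only: sum_divide_distrib)
qed

text \<open>Expanding the form at \<open>h\<close> minus the lattice point of \<open>z\<close>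
  leaves, after cancelling its value at \<open>h\<close>, the inequality
  \<open>2 * (z \<bullet> h) \<le> z \<bullet> laplacian G z\<close>.\<close>

lemma mem_Vor_origin_iff:
  assumes "Digraph_Component.connected G"
  shows "h \<in> Vor_origin G \<longleftrightarrow> h \<in> H0 \<and> (\<forall>z. of_int_vec z \<bullet> h \<le> energy (of_int_vec z))"
proof (cases "h \<in> H0")
  case True
  then obtain g where g: "laplacian G g = h" using laplacian_surj_H0[OF assms] by blast
  have "laplacian_form G (h - 0) \<le> laplacian_form G (h - of_int_vec (laplacian G z))
      \<longleftrightarrow> of_int_vec z \<bullet> h \<le> energy (of_int_vec z)" for z
  proof -
    let ?z = "of_int_vec z :: real ^ 'v"
    have "h - of_int_vec (laplacian G z) = laplacian G (g - ?z)"
      by (simp add: of_int_vec_laplacian g[symmetric] linear_diff[OF linear_laplacian])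
    then have "laplacian_form G (h - of_int_vec (laplacian G z)) = (g - ?z) \<bullet> laplacian G (g - ?z)"
      by (simp add: laplacian_form_laplacian)
    also have "\<dots> = g \<bullet> h - 2 * (?z \<bullet> h) + ?z \<bullet> laplacian G ?z"
      using inner_laplacian_commute[of g ?z]
      by (simp add: linear_diff[OF linear_laplacian] inner_diff_left inner_diff_right g)
    finally show ?thesis
      using laplacian_form_laplacian[of g] unfolding g energy_of_int_vec by auto
  qed
  with True show ?thesis by (simp add: Vor_origin_def voronoi_cell_def laplacian_lattice_def)
qed (simp add: Vor_origin_def voronoi_cell_def)

lemma energy_0: "energy 0 = 0"
  using energy_of_int_vec[of 0] by simp

text \<open>A point \<open>h\<close> of the Voronoi cell lies in the cell of some integer
  \<open>z\<close>. The Voronoi inequality for \<open>z\<close> is the reverse of the subgradient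
  inequality from \<open>z\<close> to \<open>0\<close>, so equality holds and \<open>h\<close> also
  lies in \<open>cell 0\<close>.\<close>

lemma Vor_origin_eq_cell:
  assumes "Digraph_Component.connected G"
  shows "Vor_origin G = cell 0"
proof (intro equalityI subsetI)
  fix h assume "h \<in> Vor_origin G"
  then have h: "h \<in> H0" "\<And>z. of_int_vec z \<bullet> h \<le> energy (of_int_vec z)"
    using mem_Vor_origin_iff[OF assms] by auto
  obtain z where z: "h \<in> cell (of_int_vec z)" using H0_covered[OF assms h(1)] .
  show "h \<in> cell 0"
  proof (rule cell_subgradient(2)[OF z])
    have "energy (of_int_vec z) + (0 - of_int_vec z) \<bullet> h \<le> energy 0"
      by (rule cell_subgradient(1)[OF z])
    then show "energy 0 = energy (of_int_vec z) + (0 - of_int_vec z) \<bullet> h"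
      using h(2)[of z] by (simp add: energy_0)
  qed
next
  fix h assume h: "h \<in> cell 0"
  have "of_int_vec z \<bullet> h \<le> energy (of_int_vec z)" for z
    using cell_subgradient(1)[OF h, of "of_int_vec z"] by (simp add: energy_0)
  moreover have "h \<in> H0" using h cell_subset_H0 by blast
  ultimately show "h \<in> Vor_origin G" using mem_Vor_origin_iff[OF assms] by blast
qed

lemma mem_cell_0_iff: "h \<in> cell 0 \<longleftrightarrow> (\<exists>x. h = flow_vec x \<and> (\<forall>e\<in>arcs G. \<bar>x e\<bar> \<le> 1 / 2))"
proof -
  have "tension 0 e = of_int 0" for e by (simp add: tension_def coboundary_def)
  then have "slopes (tension 0 e) = {- 1 / 2 .. 1 / 2}" for e by (simp only: slopes_of_int) simp
  then have "x \<in> slopes (tension 0 e) \<longleftrightarrow> \<bar>x\<bar> \<le> 1 / 2" for x e by (simp only: atLeastAtMost_iff abs_le_iff) auto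
  then show ?thesis unfolding cell_def by simp
qed

lemma aff_dim_cell_0:
  assumes "Digraph_Component.connected G"
  shows "aff_dim (cell 0) = aff_dim (H0 :: (real ^ 'v) set)"
proof (rule antisym)
  show "aff_dim (cell 0) \<le> aff_dim (H0 :: (real ^ 'v) set)"
    by (rule aff_dim_subset[OF cell_subset_H0])
  have "flow_vec (\<lambda>_. 0) \<in> cell 0" unfolding mem_cell_0_iff by (intro exI[of _ "\<lambda>_. 0"]) simp
  then have zero: "0 \<in> cell 0" by (simp add: flow_vec_def)
  have "h \<in> span (cell 0)" if "h \<in> H0" for h
  proof -
    obtain g where g: "laplacian G g = h" using laplacian_surj_H0[OF assms \<open>h \<in> H0\<close>] by blast
    \<comment> \<open>Dividing by \<open>s\<close> brings every arc coefficient down to at most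
      \<open>1 / 2\<close>; the summand \<open>1\<close> keeps \<open>s\<close> positive when all
      differences vanish.\<close>
    define s where "s = 2 * (1 + (\<Sum>e\<in>arcs G. \<bar>coboundary G g e\<bar>))"
    have s: "s > 0" by (auto simp: s_def intro!: add_pos_nonneg sum_nonneg)
    have "\<bar>coboundary G g e / s\<bar> \<le> 1 / 2" if "e \<in> arcs G" for e
    proof -
      have "\<bar>coboundary G g e\<bar> \<le> (\<Sum>e\<in>arcs G. \<bar>coboundary G g e\<bar>)"
        using that finite_arcs by (intro member_le_sum) auto
      then have "2 * \<bar>coboundary G g e\<bar> \<le> s" by (simp add: s_def)
      then show ?thesis using s by (simp add: abs_divide divide_le_eq)
    qed
    then have "flow_vec (\<lambda>e. coboundary G g e / s) \<in> cell 0" unfolding mem_cell_0_iff by blast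
    moreover have "h = s *\<^sub>R flow_vec (\<lambda>e. coboundary G g e / s)"
      using s by (simp add: g[symmetric] laplacian_eq_flow_vec flow_vec_def scaleR_sum_right)
    ultimately show ?thesis by (simp add: span_base span_mul)
  qed
  then have "H0 \<subseteq> affine hull (cell 0)"
    using zero by (subst affine_hull_span_0) (auto intro: hull_inc)
  then show "aff_dim (H0 :: (real ^ 'v) set) \<le> aff_dim (cell 0)"
    using aff_dim_subset aff_dim_affine_hull by metis
qed

end

section \<open>Congruence with Voronoi cells of subgraphs, and dimension\<close>

context metric_graph
begin

lemma VorH_eq_translate_Vor_origin:
  assumes "Digraph_Component.connected (Gf G l m f)"
  shows "VorH G arev l m f = (+) (coboundary_adj G (dd G l m f)) ` Vor_origin (Gf G l m f)"
proof -
  interpret H: unit_graph "Gf G l m f" arev by (simp add: unit_graph_def metric_graph_Gf)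
  have "VorH (Gf G l m f) arev (\<lambda>_. 1) (\<lambda>_. 0) 0 = Vor_origin (Gf G l m f)"
    using H.VorH_eq_cell[of 0] H.Vor_origin_eq_cell[OF assms] by simp
  then show ?thesis using VorH_translate by simp
qed

lemma aff_dim_VorH:
  assumes "Digraph_Component.connected (Gf G l m f)"
  shows "aff_dim (VorH G arev l m f) = aff_dim (H0 :: (real ^ 'v) set)"
proof -
  interpret H: unit_graph "Gf G l m f" arev by (simp add: unit_graph_def metric_graph_Gf)
  show ?thesis
    unfolding VorH_eq_translate_Vor_origin[OF assms] H.Vor_origin_eq_cell[OF assms]
    using H.aff_dim_cell_0[OF assms] by (simp add: aff_dim_translation_eq)
qed

subsection \<open>The tiling\<close>

lemma polytope_VorH: "polytope (VorH G arev l m f)"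
  by (simp add: VorH_eq_cell polytope_cell)

lemma connected_spanning_subgraph_Gf:
  assumes "Digraph_Component.connected (Gf G l m f)"
  shows "connected_spanning_subgraph (Gf G l m f) G arev"
proof -
  have "wf_digraph G" "wf_digraph (Gf G l m f)" by (auto simp: wf_digraph_def Gf_def verts)
  then show ?thesis
    using assms by (auto simp: connected_spanning_subgraph_def spanning_def subgraph_def compatible_def
        Gf_eq arev_arcs tension_arev)
qed

lemma is_tiling_Vor_tiling:
  assumes "Digraph_Component.connected G"
  shows "is_tiling (Vor_tiling G arev l m) H0"
  unfolding is_tiling_def
proof (intro conjI ballI allI impI)
  fix P assume "P \<in> Vor_tiling G arev l m"
  then obtain f where P: "P \<noteq> {}" "P face_of VorH G arev l m f"
    and f: "Digraph_Component.connected (Gf G l m f)" by (auto simp: Vor_tiling_def)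
  show "P \<noteq> {}" by fact
  show "polytope P" using face_of_polytope_polytope[OF polytope_VorH P(2)] .
  show "F \<in> Vor_tiling G arev l m" if "F face_of P \<and> F \<noteq> {}" for F
    using that face_of_trans[OF _ P(2)] f unfolding Vor_tiling_def by blast
  fix Q assume "Q \<in> Vor_tiling G arev l m"
  then obtain g where Q: "Q face_of VorH G arev l m g" by (auto simp: Vor_tiling_def)
  \<comment> \<open>Faces of two different cells are compared inside the common face
    \<open>?I\<close>: \<open>B\<close> cuts out a face of \<open>?I\<close>, which by transitivity
    is a face of \<open>cell a\<close> and can be intersected with \<open>A\<close>.\<close>
  have faces: "(A \<inter> B) face_of A"
    if A: "A face_of cell a" and B: "B face_of cell b" for A B a b
  proof -
    let ?I = "cell a \<inter> cell b"
    have "(B \<inter> ?I) face_of cell b"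
      using face_of_Int[OF B cell_Int_face_of[of b a]] by (simp add: Int_commute)
    then have "(B \<inter> ?I) face_of ?I" by (rule face_of_subset) auto
    then have "(B \<inter> ?I) face_of cell a" using cell_Int_face_of by (rule face_of_trans)
    then have "(A \<inter> (B \<inter> ?I)) face_of cell a" by (rule face_of_Int[OF A])
    then have "(A \<inter> (B \<inter> ?I)) face_of A"
      by (rule face_of_subset) (use face_of_imp_subset[OF A] in auto)
    moreover have "A \<inter> (B \<inter> ?I) = A \<inter> B"
      using face_of_imp_subset[OF A] face_of_imp_subset[OF B] by blast
    ultimately show ?thesis by simp
  qed
  have "(P \<inter> Q) face_of P" "(Q \<inter> P) face_of Q"
    using faces P(2) Q by (simp_all only: VorH_eq_cell)
  then show "P \<inter> Q = {} \<or> (P \<inter> Q) face_of P \<and> (P \<inter> Q) face_of Q"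
    by (simp add: Int_commute)
next
  show "\<Union> (Vor_tiling G arev l m) = H0"
  proof (intro equalityI subsetI)
    fix h assume "h \<in> \<Union> (Vor_tiling G arev l m)"
    then show "h \<in> H0"
      using face_of_imp_subset cell_subset_H0 by (fastforce simp: Vor_tiling_def VorH_eq_cell)
  next
    fix h :: "real ^ 'v" assume "h \<in> H0"
    then obtain f where f: "Digraph_Component.connected (Gf G l m f)" "h \<in> VorH G arev l m f"
      using H0_covered[OF assms] by (metis VorH_eq_cell)
    moreover have "VorH G arev l m f face_of VorH G arev l m f"
      by (simp add: face_of_refl polytope_imp_convex polytope_VorH)
    ultimately show "h \<in> \<Union> (Vor_tiling G arev l m)" unfolding Vor_tiling_def by blast
  qed
qed

text \<open>Every \<open>VorH\<close> with connected \<open>Gf\<close> has the dimension of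
  \<open>H0\<close>, while a proper face of a convex set has strictly smaller dimension.\<close>

lemma top_dim_cells_Vor_tiling:
  "top_dim_cells (Vor_tiling G arev l m) H0
    = {VorH G arev l m f | f. Digraph_Component.connected (Gf G l m f)}"
proof (intro equalityI subsetI)
  fix P assume "P \<in> top_dim_cells (Vor_tiling G arev l m) H0"
  then obtain f where P: "P face_of VorH G arev l m f" "aff_dim P = aff_dim (H0 :: (real ^ 'v) set)"
    and f: "Digraph_Component.connected (Gf G l m f)"
    by (auto simp: top_dim_cells_def Vor_tiling_def)
  have "P = VorH G arev l m f"
    using face_of_aff_dim_lt[OF polytope_imp_convex[OF polytope_VorH] P(1)] P(2) aff_dim_VorH[OF f] by force
  with f show "P \<in> {VorH G arev l m f | f. Digraph_Component.connected (Gf G l m f)}" by blast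
next
  fix P assume "P \<in> {VorH G arev l m f | f. Digraph_Component.connected (Gf G l m f)}"
  then obtain f where P: "P = VorH G arev l m f" and f: "Digraph_Component.connected (Gf G l m f)" by blast
  have "P face_of VorH G arev l m f"
    by (simp add: P face_of_refl polytope_imp_convex polytope_VorH)
  moreover have dim: "aff_dim P = aff_dim (H0 :: (real ^ 'v) set)" by (simp add: P aff_dim_VorH[OF f])
  moreover have "(0 :: real ^ 'v) \<in> H0" by (rule subspace_0[OF subspace_H0])
  then have "P \<noteq> {}" using dim by (metis aff_dim_empty empty_iff)
  ultimately show "P \<in> top_dim_cells (Vor_tiling G arev l m) H0"
    using f by (auto simp: top_dim_cells_def Vor_tiling_def)
qed

end

theorem theorem5p9:
  fixes G :: "('v::finite, 'e) pre_digraph"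
    and arev :: "'e \<Rightarrow> 'e"
    and l m :: "'e \<Rightarrow> int"
  assumes "fin_digraph G" and "loopfree_digraph G" and "bidirected_digraph G arev"
    and "verts G = UNIV"
    and "Digraph_Component.connected G"
    and "\<And>e. e \<in> arcs G \<Longrightarrow> 0 < l e"
    and "\<And>e. e \<in> arcs G \<Longrightarrow> l (arev e) = l e"
    and "m \<in> C1 G arev"
  shows "is_tiling (Vor_tiling G arev l m) H0
    \<and> top_dim_cells (Vor_tiling G arev l m) H0
        = {VorH G arev l m f | f. Digraph_Component.connected (Gf G l m f)}
    \<and> (\<forall>P \<in> top_dim_cells (Vor_tiling G arev l m) H0.
        \<exists>H. connected_spanning_subgraph H G arev \<and> congruent_cells P (Vor_origin H))
    \<and> (\<forall>f. Digraph_Component.connected (Gf G l m f)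
        \<longrightarrow> congruent_cells (VorH G arev l m f) (Vor_origin (Gf G l m f)))"
proof -
  interpret bidirected_digraph G arev by fact
  interpret metric_graph G arev l m
  proof
    show "finite (arcs G)" using assms(1) by (simp add: fin_digraph_def fin_digraph_axioms_def)
    show "m (arev e) = - m e" if "e \<in> arcs G" for e using assms(8) that by (simp add: C1_def)
  qed (use assms in auto)
  have congr: "congruent_cells (VorH G arev l m f) (Vor_origin (Gf G l m f))"
    if "Digraph_Component.connected (Gf G l m f)" for f
    using VorH_eq_translate_Vor_origin[OF that] unfolding congruent_cells_def by blast
  show ?thesis
  proof (intro conjI ballI allI impI)
    show "\<exists>H. connected_spanning_subgraph H G arev \<and> congruent_cells P (Vor_origin H)"
      if "P \<in> top_dim_cells (Vor_tiling G arev l m) H0" for P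
      using that congr connected_spanning_subgraph_Gf unfolding top_dim_cells_Vor_tiling by auto
  qed (fact is_tiling_Vor_tiling[OF assms(5)] top_dim_cells_Vor_tiling congr)+
qed

end
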